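(* Let $n\in\{3,4,\ldots\}$ and define $G_{\mathbf 2}:=\langle \mathrm{Alt}(X_n), g_2^2,\ldots,g_n^2\rangle$, a finite index subgroup of the Houghton group $H_n$. If $U$ is a finite index subgroup of $G_{\mathbf 2}$, then $d(U)=d(G_{\mathbf 2})=d(H_n)$.
   Context: For a finitely generated group $G$, $d(G)$ denotes the minimal size of a generating set of $G$. $\mathbb{N}=\{1,2,\ldots\}$. Permutations act on the right, so products are composed left to right. For a set $X$, $\mathrm{FSym}(X)$ is the group of bijections of $X$ with finite support, and $\mathrm{Alt}(X)\le \mathrm{FSym}(X)$ is the subgroup of even permutations. For $n\ge 3$ let $X_n=\{1,\ldots,n\}\times\mathbb{N}$ and, for $k\in\{2,\ldots,n\}$, let $g_k\in\mathrm{Sym}(X_n)$ be defined by $(1,m)g_k=(1,m+1)$ for $m\in\mathbb{N}$; $(k,1)g_k=(1,1)$; $(k,m)g_k=(k,m-1)$ for $m\ge2$; and $(i,m)g_k=(i,m)$ for $i\notin\{1,k\}$. The Houghton group is $H_n=\langle g_2,\ldots,g_n\rangle$. One has $\mathrm{FSym}(X_n)\le H_n$ and $d(H_n)=n-1$. *)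

theory Defs
  imports
    "HOL-Combinatorics.Permutations"
    "HOL-Library.Extended_Nat"
    "HOL-Algebra.Generated_Groups"
begin

text \<open>Permutations act on the right, so the product of \<open>p\<close> and \<open>q\<close> first applies \<open>p\<close>, then \<open>q\<close>.
  A permutation of \<open>X\<close> is represented by a function on the whole type that fixes every point
  outside \<open>X\<close>.\<close>

definition Sym :: "'a set \<Rightarrow> ('a \<Rightarrow> 'a) monoid"
  where "Sym X = \<lparr>carrier = {p. p permutes X}, mult = (\<lambda>p q. q \<circ> p), one = id\<rparr>"

lemma group_Sym: "group (Sym X)"
proof (rule groupI)
  fix p assume "p \<in> carrier (Sym X)"
  then have p: "p permutes X" by (simp add: Sym_def)
  then show "\<exists>q\<in>carrier (Sym X). q \<otimes>\<^bsub>Sym X\<^esub> p = \<one>\<^bsub>Sym X\<^esub>"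
    using permutes_inv[OF p] permutes_inv_o[OF p] by (auto simp: Sym_def)
qed (auto simp: Sym_def permutes_compose permutes_id o_assoc)

definition FSym :: "'a set \<Rightarrow> ('a \<Rightarrow> 'a) set"
  where "FSym X = {p. p permutes X \<and> finite {x. p x \<noteq> x}}"

text \<open>The parity \<^const>\<open>evenperm\<close> is only meaningful for finitely supported permutations.\<close>

definition Alt :: "'a set \<Rightarrow> ('a \<Rightarrow> 'a) set"
  where "Alt X = {p \<in> FSym X. evenperm p}"

definition ray_space :: "nat \<Rightarrow> (nat \<times> nat) set"
  where "ray_space n = {1..n} \<times> {1..}"

text \<open>The first clause makes the map the identity on the junk points \<open>(i, 0)\<close> outside the ray
  space.\<close>

definition houghton_gen :: "nat \<Rightarrow> nat \<times> nat \<Rightarrow> nat \<times> nat"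
  where "houghton_gen k = (\<lambda>(i, m).
    if m = 0 then (i, m)
    else if i = 1 then (1, m + 1)
    else if i = k then (if m = 1 then (1, 1) else (k, m - 1))
    else (i, m))"

lemma houghton_gen_in_Sym:
  assumes "k \<in> {2..n}"
  shows "houghton_gen k \<in> carrier (Sym (ray_space n))"
proof -
  define h :: "nat \<times> nat \<Rightarrow> nat \<times> nat" where "h = (\<lambda>(i, m).
    if m = 0 then (i, m)
    else if i = 1 then (if m = 1 then (k, 1) else (1, m - 1))
    else if i = k then (k, m + 1)
    else (i, m))"
  have "houghton_gen k (h x) = x" "h (houghton_gen k x) = x" for x
    using assms by (auto simp: h_def houghton_gen_def split: prod.splits if_splits)
  then have "bij (houghton_gen k)"
    by (metis bijI')
  moreover have "houghton_gen k x = x" if "x \<notin> ray_space n" for x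
    using that assms by (cases x) (auto simp: houghton_gen_def ray_space_def)
  ultimately show ?thesis
    by (auto simp: Sym_def permutes_def bij_iff)
qed

lemma Alt_subset_Sym: "Alt X \<subseteq> carrier (Sym X)"
  by (auto simp: Alt_def FSym_def Sym_def)

definition houghton :: "nat \<Rightarrow> (nat \<times> nat \<Rightarrow> nat \<times> nat) monoid"
  where "houghton n = subgroup_generated (Sym (ray_space n)) (houghton_gen ` {2..n})"

definition houghton_G2 :: "nat \<Rightarrow> (nat \<times> nat \<Rightarrow> nat \<times> nat) monoid"
  where "houghton_G2 n = subgroup_generated (Sym (ray_space n))
    (Alt (ray_space n) \<union> (\<lambda>k. houghton_gen k [^]\<^bsub>Sym (ray_space n)\<^esub> (2::nat)) ` {2..n})"

definition finite_index_subgroup :: "'a set \<Rightarrow> ('a, 'b) monoid_scheme \<Rightarrow> bool"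
  where "finite_index_subgroup U G \<longleftrightarrow> subgroup U G \<and> finite (rcosets\<^bsub>G\<^esub> U)"

text \<open>Minimal size of a generating set; the value is \<open>\<infinity>\<close> exactly when \<open>G\<close> is not finitely
  generated.\<close>

definition min_gens :: "('a, 'b) monoid_scheme \<Rightarrow> enat"
  where "min_gens G =
    (INF S \<in> {S. finite S \<and> S \<subseteq> carrier G \<and> generate G S = carrier G}. enat (card S))"

end

theory Submission
  imports Defs "HOL-Library.Function_Algebras"
begin

text \<open>An element of \<open>H\<^sub>n\<close> is eventually a translation on each ray, and the translation lengths on the rays
  \<open>2, \<dots>, n\<close> embed \<open>G\<^sub>2 / Alt\<close> as a lattice of full rank \<open>n - 1\<close>, because the squares of the generators
  commute modulo \<open>Alt\<close>. A subgroup \<open>U\<close> of finite index in \<open>G\<^sub>2\<close> contains \<open>Alt\<close> and again has a lattice of rank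
  \<open>n - 1\<close>, so \<open>d(U) \<ge> n - 1\<close>. For the converse take a triangular basis of the lattice and lift it to \<open>U\<close>:
  the lifts may be changed by arbitrary elements of \<open>Alt\<close>, and this freedom is used to make a conjugate
  of a commutator meet that commutator in a single point. Then the lifts generate a 3-cycle, and, being
  chosen to move that 3-cycle around all of \<open>X\<^sub>n\<close>, they generate \<open>Alt\<close> and hence \<open>U\<close>.\<close>

text \<open>Parity is what forces the squares: \<open>houghton_gen 2\<close> and
  \<open>houghton_gen 3\<close> have a transposition as commutator, whereas commutators of squares
  are even, so that \<open>G\<^sub>2\<close> meets the finitary permutations only in
  \<open>Alt\<close>. An element of \<open>G\<^sub>2\<close> is then determined modulo
  \<open>Alt\<close> by its shifts on rays 2 to n. The obstacle is that n - 1 lifts leave no spare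
  generator for \<open>Alt\<close>: the lifts themselves must produce the 3-cycle. The first row of
  the triangular basis vanishes on rays 3 to n, so its lift can be taken to be exactly a power
  \<open>a\<close> of \<open>houghton_gen 2\<close>, which fixes those rays pointwise. The second
  lift \<open>b\<close> is then arranged so that a single point of those rays drops out of the image
  under \<open>b\<close> of the fixed points of \<open>a\<close>; this is where the third ray
  enters. Spreading the 3-cycle is organised by \<open>cyc3_rel\<close>, an equivalence relation on
  points that is invariant under the group. A generator that sends one point of the class of
  \<open>(3, 1)\<close> into that class preserves all of it, so each lift needs only one such test
  point.\<close>

abbreviation inv' :: "('a \<Rightarrow> 'b) \<Rightarrow> 'b \<Rightarrow> 'a"
  where "inv' f \<equiv> Hilbert_Choice.inv f"

section \<open>The symmetric group in terms of composition of functions\<close>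

lemma mult_Sym [simp]: "p \<otimes>\<^bsub>Sym X\<^esub> q = q \<circ> p"
  by (simp add: Sym_def)

lemma one_Sym [simp]: "\<one>\<^bsub>Sym X\<^esub> = id"
  by (simp add: Sym_def)

lemma mem_carrier_Sym [simp]: "p \<in> carrier (Sym X) \<longleftrightarrow> p permutes X"
  by (simp add: Sym_def)

lemma inv_Sym:
  assumes "p permutes X"
  shows "inv\<^bsub>Sym X\<^esub> p = inv' p"
proof -
  interpret group "Sym X" by (rule group_Sym)
  show ?thesis
    by (rule inv_equality) (use assms permutes_inv[OF assms] permutes_inv_o[OF assms] in auto)
qed

lemma
  assumes "subgroup K (Sym X)"
  shows subgroup_Sym_permutes: "p \<in> K \<Longrightarrow> p permutes X"
    and subgroup_Sym_id: "id \<in> K"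
    and subgroup_Sym_comp: "p \<in> K \<Longrightarrow> q \<in> K \<Longrightarrow> p \<circ> q \<in> K"
    and subgroup_Sym_inv: "p \<in> K \<Longrightarrow> inv' p \<in> K"
proof -
  show 1: "p permutes X" if "p \<in> K" for p
    using subgroup.subset[OF assms] that by auto
  show "id \<in> K"
    using subgroup.one_closed[OF assms] by simp
  show "p \<circ> q \<in> K" if "p \<in> K" "q \<in> K"
    using subgroup.m_closed[OF assms that(2,1)] by simp
  show "inv' p \<in> K" if "p \<in> K"
    using subgroup.m_inv_closed[OF assms that] inv_Sym[OF 1[OF that]] by simp
qed

lemma subgroup_Sym_funpow:
  assumes "subgroup K (Sym X)" "p \<in> K"
  shows "p ^^ N \<in> K"
proof (induction N)
  case (Suc N)
  then show ?case using subgroup_Sym_comp[OF assms Suc] by (simp add: o_def)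
qed (use subgroup_Sym_id[OF assms(1)] in \<open>simp add: id_def\<close>)

section \<open>Three-cycles\<close>

definition cyc3 :: "'a \<Rightarrow> 'a \<Rightarrow> 'a \<Rightarrow> 'a \<Rightarrow> 'a"
  where "cyc3 x y z = transpose x y \<circ> transpose y z"

lemma cyc3_apply:
  assumes "distinct [x, y, z]"
  shows "cyc3 x y z w = (if w = x then y else if w = y then z else if w = z then x else w)"
  using assms by (auto simp: cyc3_def transpose_def)

lemma cyc3_rotate: "distinct [x, y, z] \<Longrightarrow> cyc3 x y z = cyc3 y z x"
  by (rule ext) (auto simp: cyc3_apply)

lemma inv_cyc3: "distinct [x, y, z] \<Longrightarrow> inv' (cyc3 x y z) = cyc3 y x z"
  by (intro inv_unique_comp ext) (auto simp: cyc3_apply split: if_splits)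

lemma bij_cyc3: "bij (cyc3 x y z)"
  by (simp add: cyc3_def bij_comp)

lemma conj_cyc3:
  assumes "bij g" "distinct [x, y, z]"
  shows "g \<circ> cyc3 x y z \<circ> inv' g = cyc3 (g x) (g y) (g z)"
proof
  fix w
  have "inj g" and w: "g (inv' g w) = w"
    using assms(1) by (auto simp: bij_def surj_f_inv_f)
  then have d: "distinct [g x, g y, g z]"
    using assms(2) by (auto simp: inj_eq)
  show "(g \<circ> cyc3 x y z \<circ> inv' g) w = cyc3 (g x) (g y) (g z) w"
    using \<open>inj g\<close> w by (auto simp: cyc3_apply[OF d] cyc3_apply[OF assms(2)])
qed

lemma cyc3_permutes: "x \<in> X \<Longrightarrow> y \<in> X \<Longrightarrow> z \<in> X \<Longrightarrow> cyc3 x y z permutes X"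
  unfolding cyc3_def by (intro permutes_compose permutes_swap_id)

lemma permutation_of_FSym: "p \<in> FSym X \<Longrightarrow> permutation p"
  by (auto simp: FSym_def permutation permutes_bij)

lemma FSym_comp: "p \<in> FSym X \<Longrightarrow> q \<in> FSym X \<Longrightarrow> p \<circ> q \<in> FSym X"
  using permutation_compose[of p q] permutation_of_FSym[of p X] permutation_of_FSym[of q X]
  by (auto simp: FSym_def permutes_compose permutation)

lemma FSym_inv: "p \<in> FSym X \<Longrightarrow> inv' p \<in> FSym X"
  using permutation_inverse[of p] permutation_of_FSym[of p X]
  by (auto simp: FSym_def permutes_inv permutation)

lemma Alt_comp: "p \<in> Alt X \<Longrightarrow> q \<in> Alt X \<Longrightarrow> p \<circ> q \<in> Alt X"
  by (auto simp: Alt_def FSym_comp evenperm_comp permutation_of_FSym)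

lemma Alt_inv: "p \<in> Alt X \<Longrightarrow> inv' p \<in> Alt X"
  by (auto simp: Alt_def FSym_inv evenperm_inv permutation_of_FSym)

lemma Alt_mono: "X \<subseteq> Y \<Longrightarrow> Alt X \<subseteq> Alt Y"
  by (auto simp: Alt_def FSym_def intro: permutes_subset)

lemma cyc3_in_Alt:
  assumes "x \<in> X" "y \<in> X" "z \<in> X" "distinct [x, y, z]"
  shows "cyc3 x y z \<in> Alt X"
proof -
  have "permutation (cyc3 x y z)"
    unfolding cyc3_def by (intro permutation_compose permutation_swap_id)
  moreover have "evenperm (cyc3 x y z)"
    unfolding cyc3_def using assms
    by (subst evenperm_comp) (auto simp: permutation_swap_id evenperm_swap)
  ultimately show ?thesis
    using assms by (auto simp: Alt_def FSym_def cyc3_permutes permutation)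
qed

lemma id_in_FSym: "id \<in> FSym X"
  by (simp add: FSym_def permutes_id)

lemma id_in_Alt: "id \<in> Alt X"
  by (simp add: Alt_def id_in_FSym)

lemma subgroup_FSym: "subgroup (FSym X) (Sym X)"
proof (rule group.subgroupI[OF group_Sym])
  show "inv\<^bsub>Sym X\<^esub> p \<in> FSym X" if "p \<in> FSym X" for p
    using that FSym_inv[OF that] inv_Sym[of p X] by (simp add: FSym_def)
  show "FSym X \<subseteq> carrier (Sym X)"
    by (auto simp: FSym_def)
  show "FSym X \<noteq> {}"
    using id_in_FSym[of X] by blast
  show "p \<otimes>\<^bsub>Sym X\<^esub> q \<in> FSym X" if "p \<in> FSym X" "q \<in> FSym X" for p q
    using that by (simp add: FSym_comp)
qed

lemma subgroup_Alt: "subgroup (Alt X) (Sym X)"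
proof (rule group.subgroupI[OF group_Sym])
  show "inv\<^bsub>Sym X\<^esub> p \<in> Alt X" if "p \<in> Alt X" for p
    using that Alt_inv[OF that] inv_Sym[of p X] by (simp add: Alt_def FSym_def)
  show "Alt X \<subseteq> carrier (Sym X)"
    by (auto simp: Alt_def FSym_def)
  show "Alt X \<noteq> {}"
    using id_in_Alt[of X] by blast
  show "p \<otimes>\<^bsub>Sym X\<^esub> q \<in> Alt X" if "p \<in> Alt X" "q \<in> Alt X" for p q
    using that by (simp add: Alt_comp)
qed

text \<open>Composing with a 3-cycle \<open>(p x, x, z)\<close>, where \<open>z\<close> is a third moved point, makes \<open>x\<close> a fixed point.\<close>

lemma Alt_subset_if_cyc3:
  assumes K: "subgroup K (Sym X)"
    and cyc: "\<And>x y z. x \<in> X \<Longrightarrow> y \<in> X \<Longrightarrow> z \<in> X \<Longrightarrow> distinct [x, y, z] \<Longrightarrow> cyc3 x y z \<in> K"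
  shows "Alt X \<subseteq> K"
proof
  fix p assume "p \<in> Alt X"
  then show "p \<in> K"
  proof (induction "card {x. p x \<noteq> x}" arbitrary: p rule: less_induct)
    case less
    have p: "p permutes X" and fin: "finite {x. p x \<noteq> x}" and ev: "evenperm p"
      using less.prems by (auto simp: Alt_def FSym_def)
    show ?case
    proof (cases "p = id")
      case True
      then show ?thesis using subgroup_Sym_id[OF K] by simp
    next
      case False
      then obtain x where x: "p x \<noteq> x" by (auto simp: fun_eq_iff)
      define y where "y = p x"
      have y: "p y \<noteq> y"
        using x permutes_inj[OF p] by (auto simp: y_def inj_eq)
      \<comment> \<open>With only two moved points \<open>p\<close> would be a transposition, hence
        odd.\<close>
      have "\<exists>z. p z \<noteq> z \<and> z \<noteq> x \<and> z \<noteq> y"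
      proof (rule ccontr)
        assume *: "\<not> ?thesis"
        have "p y = x"
          using * y permutes_inj[OF p] by (metis inj_eq)
        then have "p = transpose x y"
          using * by (auto simp: fun_eq_iff transpose_def y_def)
        then show False using ev x evenperm_swap[of x y] by (simp add: y_def)
      qed
      then obtain z where z: "p z \<noteq> z" "z \<noteq> x" "z \<noteq> y" by blast
      have inX: "x \<in> X" "y \<in> X" "z \<in> X"
        using x y z p by (auto simp: permutes_def)
      have d: "distinct [y, x, z]" using x z by (auto simp: y_def)
      define q where "q = cyc3 y x z \<circ> p"
      have qA: "q \<in> Alt X"
        unfolding q_def using less.prems inX d by (intro Alt_comp cyc3_in_Alt)
      have qx: "q x = x"
        using d by (simp add: q_def y_def[symmetric] cyc3_apply)
      have "q w = w" if "p w = w" for w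
        using that x y z d by (auto simp: q_def cyc3_apply)
      then have "{w. q w \<noteq> w} \<subset> {w. p w \<noteq> w}"
        using qx x by blast
      then have "q \<in> K"
        using less.hyps qA fin by (simp add: psubset_card_mono)
      moreover have "inv' (cyc3 y x z) \<in> K"
        using cyc inX d subgroup_Sym_inv[OF K] by blast
      moreover have "p = inv' (cyc3 y x z) \<circ> q"
        by (simp add: q_def o_assoc bij_cyc3 bij_is_inj)
      ultimately show ?thesis
        using subgroup_Sym_comp[OF K] by metis
    qed
  qed
qed

text \<open>The third point is left free. For a subgroup \<open>K\<close> this is an equivalence
  relation invariant under \<open>K\<close>, and \<open>K\<close> contains \<open>Alt X\<close> once
  all of \<open>X\<close> lies in one class.\<close>

definition cyc3_rel :: "('a \<Rightarrow> 'a) set \<Rightarrow> 'a \<Rightarrow> 'a \<Rightarrow> bool"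
  where "cyc3_rel K x y \<longleftrightarrow> x = y \<or> (\<exists>z. distinct [x, y, z] \<and> cyc3 x y z \<in> K)"

lemma cyc3_relI: "distinct [x, y, z] \<Longrightarrow> cyc3 x y z \<in> K \<Longrightarrow> cyc3_rel K x y"
  by (auto simp: cyc3_rel_def)

lemma cyc3_rel_refl: "cyc3_rel K x x"
  by (simp add: cyc3_rel_def)

context
  fixes K :: "('a \<Rightarrow> 'a) set" and X :: "'a set"
  assumes K: "subgroup K (Sym X)"
begin

lemma cyc3_conj_closed: "g \<in> K \<Longrightarrow> distinct [x, y, z] \<Longrightarrow> cyc3 x y z \<in> K \<Longrightarrow> cyc3 (g x) (g y) (g z) \<in> K"
  using conj_cyc3[of g x y z] subgroup_Sym_comp[OF K] subgroup_Sym_inv[OF K]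
    permutes_bij[OF subgroup_Sym_permutes[OF K]] by metis

lemma cyc3_inv_closed: "distinct [x, y, z] \<Longrightarrow> cyc3 x y z \<in> K \<Longrightarrow> cyc3 y x z \<in> K"
  using inv_cyc3 subgroup_Sym_inv[OF K] by metis

lemma cyc3_rel_sym: "cyc3_rel K x y \<Longrightarrow> cyc3_rel K y x"
  using cyc3_inv_closed unfolding cyc3_rel_def by force

lemma cyc3_rel_map:
  assumes "g \<in> K" "cyc3_rel K x y"
  shows "cyc3_rel K (g x) (g y)"
proof -
  have "inj g"
    using assms(1) subgroup_Sym_permutes[OF K] permutes_inj by blast
  show ?thesis
  proof (cases "x = y")
    case False
    then obtain z where z: "distinct [x, y, z]" "cyc3 x y z \<in> K"
      using assms(2) by (auto simp: cyc3_rel_def)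
    have "distinct [g x, g y, g z]"
      using z \<open>inj g\<close> by (auto simp: inj_eq)
    then show ?thesis
      using cyc3_conj_closed[OF assms(1) z] by (rule cyc3_relI)
  qed (simp add: cyc3_rel_refl)
qed

text \<open>The inverse of a 3-cycle \<open>(x y z)\<close> in \<open>K\<close> maps
  \<open>y\<close> to \<open>x\<close> and fixes \<open>w\<close> unless \<open>z = w\<close>, so it
  carries the related pair \<open>y\<close>, \<open>w\<close> to \<open>x\<close>, \<open>w\<close>.
  If \<open>z = w\<close>, the 3-cycle itself already relates \<open>w\<close> and
  \<open>x\<close>.\<close>

lemma cyc3_rel_trans:
  assumes "cyc3_rel K x y" "cyc3_rel K y w"
  shows "cyc3_rel K x w"
proof (cases "x = y \<or> y = w \<or> x = w")
  case False
  then obtain z where z: "distinct [x, y, z]" "cyc3 x y z \<in> K"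
    using assms by (auto simp: cyc3_rel_def)
  show ?thesis
  proof (cases "z = w")
    case True
    then have "cyc3_rel K w x"
      using z cyc3_rotate[of x y z] cyc3_rotate[of y z x] by (intro cyc3_relI[of w x y]) auto
    then show ?thesis by (rule cyc3_rel_sym)
  next
    case w: False
    have d: "distinct [y, x, z]" using z by auto
    have "cyc3_rel K (cyc3 y x z y) (cyc3 y x z w)"
      using cyc3_inv_closed[OF z] assms(2) by (rule cyc3_rel_map)
    then show ?thesis
      using d w False by (auto simp: cyc3_apply)
  qed
qed (use assms cyc3_rel_refl in auto)

text \<open>Elements of \<open>K\<close> permute the classes, so one that sends a single member
  \<open>y\<close> of a class back into it maps that class onto itself.\<close>

lemma cyc3_rel_cong_map:
  assumes "g \<in> K" "cyc3_rel K x y" "cyc3_rel K x (g y)"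
  shows "cyc3_rel K x (g z) \<longleftrightarrow> cyc3_rel K x z"
proof
  assume "cyc3_rel K x z"
  then have "cyc3_rel K y z"
    using assms(2) cyc3_rel_sym cyc3_rel_trans by blast
  then show "cyc3_rel K x (g z)"
    using cyc3_rel_map[OF assms(1)] cyc3_rel_trans assms(3) by blast
next
  assume "cyc3_rel K x (g z)"
  then have "cyc3_rel K (g y) (g z)"
    using assms(3) cyc3_rel_sym cyc3_rel_trans by blast
  then have "cyc3_rel K (inv' g (g y)) (inv' g (g z))"
    by (rule cyc3_rel_map[OF subgroup_Sym_inv[OF K assms(1)]])
  then have "cyc3_rel K y z"
    using permutes_inverses(2)[OF subgroup_Sym_permutes[OF K assms(1)]] by simp
  then show "cyc3_rel K x z"
    using assms(2) cyc3_rel_trans by blast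
qed

text \<open>Relatedness only supplies some 3-cycle \<open>(x y v)\<close>. Conjugating by a 3-cycle
  through \<open>v\<close> and \<open>z\<close> moves \<open>v\<close> to \<open>z\<close>; if the
  last point \<open>w\<close> of that cycle is \<open>x\<close> or \<open>y\<close>, its inverse is
  used instead and the result is the inverse of the wanted cycle.\<close>

lemma cyc3_mem_if_rel:
  assumes d: "distinct [x, y, z]" and R: "cyc3_rel K x y" "cyc3_rel K y z"
  shows "cyc3 x y z \<in> K"
proof -
  obtain v where v: "distinct [x, y, v]" "cyc3 x y v \<in> K"
    using R(1) d by (auto simp: cyc3_rel_def)
  show ?thesis
  proof (cases "v = z")
    case False
    have "cyc3_rel K v x"
      using v cyc3_rotate[of x y v] cyc3_rotate[of y v x] by (intro cyc3_relI[of v x y]) auto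
    then have "cyc3_rel K v z"
      using R cyc3_rel_trans by blast
    then obtain w where w: "distinct [v, z, w]" "cyc3 v z w \<in> K"
      using False by (auto simp: cyc3_rel_def)
    have w': "cyc3 z v w \<in> K" "distinct [z, v, w]"
      using cyc3_inv_closed[OF w] w by auto
    consider "w = x" | "w = y" | "w \<notin> {x, y}" by blast
    then show ?thesis
    proof cases
      case 1
      have "cyc3 (cyc3 z v w x) (cyc3 z v w y) (cyc3 z v w v) \<in> K"
        using w'(1) v by (rule cyc3_conj_closed)
      moreover have "cyc3 z v w x = z" "cyc3 z v w y = y" "cyc3 z v w v = x"
        using w'(2) v(1) d 1 by (auto simp: cyc3_apply)
      ultimately have "cyc3 z y x \<in> K" by simp
      then have "cyc3 y z x \<in> K"
        using cyc3_inv_closed d by auto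
      then show ?thesis
        using cyc3_rotate[of x y z] d by auto
    next
      case 2
      have "cyc3 (cyc3 z v w x) (cyc3 z v w y) (cyc3 z v w v) \<in> K"
        using w'(1) v by (rule cyc3_conj_closed)
      moreover have "cyc3 z v w x = x" "cyc3 z v w y = z" "cyc3 z v w v = y"
        using w'(2) v(1) d 2 by (auto simp: cyc3_apply)
      ultimately have "cyc3 x z y \<in> K" by simp
      then have "cyc3 z x y \<in> K"
        using cyc3_inv_closed d by auto
      then show ?thesis
        using cyc3_rotate[of z x y] d by auto
    next
      case 3
      have "cyc3 (cyc3 v z w x) (cyc3 v z w y) (cyc3 v z w v) \<in> K"
        using w(2) v by (rule cyc3_conj_closed)
      moreover have "cyc3 v z w x = x" "cyc3 v z w y = y" "cyc3 v z w v = z"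
        using w(1) v(1) d 3 by (auto simp: cyc3_apply)
      ultimately show ?thesis by simp
    qed
  qed (use v in simp)
qed

lemma Alt_subset_if_cyc3_rel:
  assumes "\<And>x. x \<in> X \<Longrightarrow> cyc3_rel K y x"
  shows "Alt X \<subseteq> K"
proof (rule Alt_subset_if_cyc3[OF K])
  fix x z w assume "x \<in> X" "z \<in> X" "w \<in> X" and d: "distinct [x, z, w]"
  then have "cyc3_rel K x z" "cyc3_rel K z w"
    using cyc3_rel_trans[OF cyc3_rel_sym[OF assms] assms] by auto
  with d show "cyc3 x z w \<in> K" by (rule cyc3_mem_if_rel)
qed

end

text \<open>Each point other than \<open>y\<close> is fixed by \<open>d\<close> or by
  \<open>e\<close>. In particular \<open>d\<close> fixes \<open>e y\<close> and \<open>e\<close>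
  fixes \<open>d y\<close>, so the two maps fail to commute only around \<open>y\<close>, and the
  commutator moves just \<open>y\<close>, \<open>e y\<close> and \<open>d y\<close>.\<close>

lemma commutator_eq_cyc3:
  assumes "bij d" "bij e" and y: "{x. d x \<noteq> x} \<inter> {x. e x \<noteq> x} = {y}"
  shows "distinct [y, e y, d y]" "e \<circ> d \<circ> inv' e \<circ> inv' d = cyc3 y (e y) (d y)"
proof -
  have inj: "inj d" "inj e" using assms by (auto simp: bij_def)
  have inv: "inv' d (d x) = x" "inv' e (e x) = x" "d (inv' d x) = x" "e (inv' e x) = x" for x
    using assms(1,2) by (auto simp: bij_def surj_f_inv_f)
  have fix_d: "inv' d x = x" if "d x = x" for x using inv that by metis
  have fix_e: "inv' e x = x" if "e x = x" for x using inv that by metis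
  have moved: "d y \<noteq> y" "e y \<noteq> y" and only: "\<And>x. x \<noteq> y \<Longrightarrow> d x = x \<or> e x = x"
    using y by auto
  have edy: "e (d y) = d y"
    using only[of "d y"] moved inj by (auto simp: inj_eq)
  have dey: "d (e y) = e y"
    using only[of "e y"] moved inj by (auto simp: inj_eq)
  show dist: "distinct [y, e y, d y]"
    using moved edy inj_eq[OF inj(2), of y "d y"] by auto
  show "e \<circ> d \<circ> inv' e \<circ> inv' d = cyc3 y (e y) (d y)"
  proof
    fix z
    have 1: "e (inv' d y) = inv' d y"
      using only[of "inv' d y"] moved(1) inv by metis
    have 2: "d (inv' e y) = inv' e y"
      using only[of "inv' e y"] moved(2) inv by metis
    have "e (d (inv' e (inv' d z))) = cyc3 y (e y) (d y) z"
    proof -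
      consider "z = y" | "z = e y" | "z = d y" | "z \<notin> {y, e y, d y}" by blast
      then show ?thesis
      proof cases
        case 1
        then show ?thesis
          using dist fix_e[of "inv' d y"] \<open>e (inv' d y) = inv' d y\<close> inv
          by (simp add: cyc3_apply[OF dist])
      next
        case 2
        then show ?thesis
          using dist fix_d[OF dey] inv edy by (auto simp: cyc3_apply[OF dist])
      next
        case 3
        then show ?thesis
          using dist inv 2 by (auto simp: cyc3_apply[OF dist])
      next
        case 4
        have "inv' d z \<noteq> y" "inv' e z \<noteq> y" using 4 inv by auto
        show ?thesis
        proof (cases "d z = z")
          case True
          have "d (inv' e z) = inv' e z"
          proof (cases "e z = z")
            case False
            then have "e (inv' e z) \<noteq> inv' e z" using inv by metis
            then show ?thesis using only \<open>inv' e z \<noteq> y\<close> by blast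
          qed (use True fix_e in simp)
          then show ?thesis
            using 4 True fix_d inv by (simp add: cyc3_apply[OF dist])
        next
          case False
          then have e: "e z = z" using only 4 by auto
          have "d (inv' d z) \<noteq> inv' d z" using False inv by metis
          then have "e (inv' d z) = inv' d z" using only \<open>inv' d z \<noteq> y\<close> by blast
          then show ?thesis
            using 4 fix_e inv e by (simp add: cyc3_apply[OF dist])
        qed
      qed
    qed
    then show "(e \<circ> d \<circ> inv' e \<circ> inv' d) z = cyc3 y (e y) (d y) z" by simp
  qed
qed

text \<open>The commutator \<open>d\<close> of \<open>a\<close> and \<open>b\<close> moves exactly one fixed point \<open>y\<close> of \<open>a\<close>, so its support meets
  that of a conjugate of \<open>d\<close> by a large power of \<open>a\<close> only in \<open>y\<close>.\<close>

lemma cyc3_rel_commutator: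
  assumes K: "subgroup K (Sym X)" and ab: "a \<in> K" "b \<in> K"
    and fin: "finite {x. (b \<circ> a \<circ> inv' b \<circ> inv' a) x \<noteq> x}"
    and y: "{x. a x = x} - b ` {x. a x = x} = {y}"
    and wander: "\<And>D. finite D \<Longrightarrow> \<exists>N. \<forall>x\<in>D. a x \<noteq> x \<longrightarrow> (a ^^ N) x \<notin> D"
  shows "cyc3_rel K y (b (a (inv' b y)))"
proof -
  define d where "d = b \<circ> a \<circ> inv' b \<circ> inv' a"
  define D where "D = {x. d x \<noteq> x}"
  have bij: "bij a" "bij b"
    using ab subgroup_Sym_permutes[OF K] permutes_bij by blast+
  have inv: "inv' a (a x) = x" "inv' b (b x) = x" "a (inv' a x) = x" "b (inv' b x) = x" for x
    using bij by (auto simp: bij_def surj_f_inv_f)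
  have dK: "d \<in> K"
    unfolding d_def using ab by (intro subgroup_Sym_comp[OF K] subgroup_Sym_inv[OF K])
  \<comment> \<open>On a fixed point of \<open>a\<close> the commutator acts as the conjugate of
    \<open>a\<close> by \<open>b\<close>, whose fixed points are the images under \<open>b\<close>
    of those of \<open>a\<close>.\<close>
  have moves: "x \<in> D \<longleftrightarrow> x = y" if "a x = x" for x
  proof -
    have "inv' a x = x" using that inv by metis
    then have "x \<in> D \<longleftrightarrow> b (a (inv' b x)) \<noteq> b (inv' b x)"
      by (simp add: D_def d_def inv)
    also have "\<dots> \<longleftrightarrow> a (inv' b x) \<noteq> inv' b x"
      using bij by (simp add: bij_def inj_eq)
    also have "\<dots> \<longleftrightarrow> x \<notin> b ` {x. a x = x}"
      using inv image_eqI[of x b "inv' b x"] by auto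
    finally show ?thesis using that y by auto
  qed
  have ay: "a y = y" using y by auto
  have dy: "d y = b (a (inv' b y))"
    using ay inv(1)[of y] by (simp add: d_def)
  have "finite D" using fin by (simp add: D_def d_def)
  from wander[OF this] obtain N where N: "\<And>x. x \<in> D \<Longrightarrow> a x \<noteq> x \<Longrightarrow> (a ^^ N) x \<notin> D"
    by auto
  define g where "g = a ^^ N"
  have gK: "g \<in> K" using subgroup_Sym_funpow[OF K ab(1)] by (simp add: g_def)
  then have bg: "bij g" using subgroup_Sym_permutes[OF K] permutes_bij by blast
  define e where "e = g \<circ> d \<circ> inv' g"
  have eK: "e \<in> K"
    unfolding e_def using gK dK by (intro subgroup_Sym_comp[OF K] subgroup_Sym_inv[OF K])
  have invg: "inv' g (g x) = x" "g (inv' g x) = x" for x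
    using bg by (auto simp: bij_def surj_f_inv_f)
  have gfix: "g x = x" if "a x = x" for x
    unfolding g_def using that by (induction N) auto
  have e: "e x \<noteq> x \<longleftrightarrow> inv' g x \<in> D" for x
  proof -
    have "e x = x \<longleftrightarrow> g (d (inv' g x)) = g (inv' g x)"
      by (simp add: e_def invg)
    also have "\<dots> \<longleftrightarrow> d (inv' g x) = inv' g x"
      using bg by (simp add: bij_def inj_eq)
    finally show ?thesis by (simp add: D_def)
  qed
  have "D \<inter> {x. e x \<noteq> x} = {y}"
  proof safe
    \<comment> \<open>Both \<open>inv' g x\<close> and its image \<open>x\<close> under
      \<open>g\<close> lie in \<open>D\<close>; by the choice of \<open>N\<close> such a point is
      not moved by \<open>a\<close>, hence not by \<open>g\<close>.\<close>
    fix x assume x: "x \<in> D" "e x \<noteq> x"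
    then have "inv' g x \<in> D" using e by blast
    moreover have "g (inv' g x) \<in> D" using x invg by simp
    ultimately have "a (inv' g x) = inv' g x" using N g_def by blast
    then show "x = y" using moves x(1) gfix invg by metis
  next
    show "y \<in> D" using moves ay by blast
    then show "e y = y \<Longrightarrow> False"
      using e[of y] gfix[OF ay] invg(1)[of y] by simp
  qed
  then have *: "{x. d x \<noteq> x} \<inter> {x. e x \<noteq> x} = {y}" by (simp add: D_def)
  have "bij d" "bij e"
    using dK eK subgroup_Sym_permutes[OF K] permutes_bij by blast+
  note c = commutator_eq_cyc3[OF this *]
  have "cyc3 y (e y) (d y) \<in> K"
    unfolding c(2)[symmetric] using dK eK by (intro subgroup_Sym_comp[OF K] subgroup_Sym_inv[OF K])
  then have "cyc3 (e y) y (d y) \<in> K"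
    by (rule cyc3_inv_closed[OF K c(1)])
  then have "cyc3 y (d y) (e y) \<in> K"
    using cyc3_rotate[of "e y" y "d y"] c(1) by auto
  then have "cyc3_rel K y (d y)"
    using c(1) by (intro cyc3_relI) auto
  then show ?thesis by (simp add: dy)
qed

text \<open>In an infinite set evenness costs nothing: each new point is corrected by a 3-cycle
  instead of a transposition, with a third point \<open>w\<close> that avoids the values prescribed
  so far.\<close>

lemma Alt_extend_inj:
  assumes "infinite Y" "finite E" "inj_on f E" "inj_on h E" "f ` E \<subseteq> Y" "h ` E \<subseteq> Y"
  shows "\<exists>s\<in>Alt Y. \<forall>x\<in>E. s (f x) = h x"
  using assms(2-)
proof (induction E)
  case empty
  then show ?case using id_in_Alt by auto
next
  case (insert x E)
  then obtain s where s: "s \<in> Alt Y" "\<forall>x\<in>E. s (f x) = h x" by auto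
  have sp: "s permutes Y" using s by (auto simp: Alt_def FSym_def)
  show ?case
  proof (cases "s (f x) = h x")
    case False
    have "infinite (Y - (h ` E \<union> {s (f x), h x}))"
      using assms(1) insert.hyps by (intro Diff_infinite_finite) auto
    then obtain w where w: "w \<in> Y" "w \<notin> h ` E" "w \<noteq> s (f x)" "w \<noteq> h x"
      using infinite_imp_nonempty by blast
    define c where "c = cyc3 (s (f x)) (h x) w"
    have d: "distinct [s (f x), h x, w]" using False w by auto
    have "s (f x) \<in> Y" using sp insert.prems by (simp add: permutes_in_image)
    then have "c \<in> Alt Y"
      unfolding c_def using w insert.prems d by (intro cyc3_in_Alt) auto
    moreover have "(c \<circ> s) (f z) = h z" if "z \<in> insert x E" for z
    proof (cases "z = x")
      case False
      then have z: "z \<in> E" using that by auto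
      have "s (f z) \<noteq> s (f x)"
        using permutes_inj[OF sp] inj_onD[OF insert.prems(1), of z x] z False by (auto simp: inj_eq)
      moreover have "h z \<noteq> h x"
        using inj_onD[OF insert.prems(2), of z x] z False by auto
      ultimately show ?thesis
        using s(2) z w d by (auto simp: c_def cyc3_apply)
    qed (use d in \<open>simp add: c_def cyc3_apply\<close>)
    ultimately show ?thesis using Alt_comp[OF _ s(1)] by blast
  qed (use s in auto)
qed

section \<open>Finite index and abelian extensions\<close>

text \<open>Pigeonhole on pairs of cosets, so that the same two indices serve both families. For two
  families of 3-cycles this relates two given points to one common point.\<close>

lemma (in group) finite_index_pigeonhole:
  assumes U: "finite_index_subgroup U G" and I: "infinite I"
    and f: "\<And>i. i \<in> I \<Longrightarrow> f i \<in> carrier G" and g: "\<And>i. i \<in> I \<Longrightarrow> g i \<in> carrier G"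
  shows "\<exists>i\<in>I. \<exists>j\<in>I. i \<noteq> j \<and> f i \<otimes> inv f j \<in> U \<and> g i \<otimes> inv g j \<in> U"
proof -
  have sub: "subgroup U G" and fin: "finite (rcosets U)"
    using U by (auto simp: finite_index_subgroup_def)
  define F where "F = (\<lambda>i. (U #> f i, U #> g i))"
  have "F ` I \<subseteq> (rcosets U) \<times> (rcosets U)"
    using f g by (auto simp: F_def RCOSETS_def)
  then have "finite (F ` I)"
    using fin by (meson finite_SigmaI finite_subset)
  from pigeonhole_infinite[OF I this] obtain i where i: "i \<in> I" "infinite {j \<in> I. F j = F i}"
    by auto
  then have "infinite ({j \<in> I. F j = F i} - {i})" by simp
  then obtain j where j: "j \<in> I" "F j = F i" "j \<noteq> i"
    using infinite_imp_nonempty by blast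
  have quot: "a \<otimes> inv b \<in> U" if "U #> a = U #> b" "a \<in> carrier G" "b \<in> carrier G" for a b
  proof -
    have "a \<in> U #> b" using rcos_self[OF that(2) sub] that(1) by simp
    then obtain u where "u \<in> U" "a = u \<otimes> b" by (auto simp: r_coset_def)
    then show ?thesis
      using subgroup.mem_carrier[OF sub] that(3) by (simp add: m_assoc)
  qed
  have "f j \<otimes> inv f i \<in> U" "g j \<otimes> inv g i \<in> U"
    using i j f g by (auto simp: F_def intro!: quot)
  then show ?thesis using i j by blast
qed

lemma finite_index_pigeonhole_Sym:
  assumes H: "subgroup H (Sym X)" and U: "finite_index_subgroup U ((Sym X)\<lparr>carrier := H\<rparr>)"
    and I: "infinite I" and f: "\<And>i. i \<in> I \<Longrightarrow> f i \<in> H" and g: "\<And>i. i \<in> I \<Longrightarrow> g i \<in> H"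
  shows "\<exists>i\<in>I. \<exists>j\<in>I. i \<noteq> j \<and> inv' (f j) \<circ> f i \<in> U \<and> inv' (g j) \<circ> g i \<in> U"
proof -
  interpret S: group "Sym X" by (rule group_Sym)
  interpret H: group "(Sym X)\<lparr>carrier := H\<rparr>" by (rule S.subgroup_imp_group[OF H])
  have inv: "inv\<^bsub>(Sym X)\<lparr>carrier := H\<rparr>\<^esub> h = inv' h" if "h \<in> H" for h
    using S.m_inv_consistent[OF H that] inv_Sym[OF subgroup_Sym_permutes[OF H that]] by simp
  show ?thesis
    using H.finite_index_pigeonhole[OF U I, of f g] f g inv by fastforce
qed

text \<open>Two members of the family \<open>(x, y, p)\<close> that lie in one coset differ by the 3-cycle \<open>(y, p, q)\<close>.\<close>

lemma Alt_subset_finite_index: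
  assumes X: "infinite X" and H: "subgroup H (Sym X)" "Alt X \<subseteq> H"
    and U: "finite_index_subgroup U ((Sym X)\<lparr>carrier := H\<rparr>)"
  shows "Alt X \<subseteq> U"
proof -
  interpret S: group "Sym X" by (rule group_Sym)
  have subU: "subgroup U (Sym X)"
    using S.incl_subgroup[OF H(1)] U by (simp add: finite_index_subgroup_def)
  have rel: "cyc3_rel U y z" if yz: "y \<in> X" "z \<in> X" for y z
  proof -
    have "infinite (X - {y, z})" using X by simp
    then obtain x where x: "x \<in> X" "x \<noteq> y" "x \<noteq> z"
      using infinite_imp_nonempty by blast
    define I where "I = X - {x, y, z}"
    have "infinite I" using X by (simp add: I_def)
    have cyc: "cyc3 x y p \<in> H" "cyc3 x z p \<in> H" if "p \<in> I" for p
      using that H(2) x yz cyc3_in_Alt[of x X y p] cyc3_in_Alt[of x X z p] by (auto simp: I_def)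
    from finite_index_pigeonhole_Sym[where f = "cyc3 x y" and g = "cyc3 x z", OF H(1) U \<open>infinite I\<close> cyc]
    obtain p q where pq: "p \<in> I" "q \<in> I" "p \<noteq> q"
      "inv' (cyc3 x y q) \<circ> cyc3 x y p \<in> U" "inv' (cyc3 x z q) \<circ> cyc3 x z p \<in> U"
      by blast
    have quot: "inv' (cyc3 x w q) \<circ> cyc3 x w p = cyc3 w p q" if "w \<in> {y, z}" for w
    proof -
      have d: "distinct [x, w, q]" "distinct [x, w, p]" "distinct [w, x, q]" "distinct [w, p, q]"
        using pq x that by (auto simp: I_def)
      show ?thesis
        unfolding inv_cyc3[OF d(1)]
        by (rule ext) (use d in \<open>auto simp: cyc3_apply[OF d(2)] cyc3_apply[OF d(3)] cyc3_apply[OF d(4)]\<close>)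
    qed
    have "cyc3_rel U y p"
      using pq quot[of y] by (intro cyc3_relI[of y p q]) (auto simp: I_def)
    moreover have "cyc3_rel U z p"
      using pq quot[of z] by (intro cyc3_relI[of z p q]) (auto simp: I_def)
    ultimately show ?thesis
      using cyc3_rel_trans[OF subU] cyc3_rel_sym[OF subU] by blast
  qed
  from X obtain y where "y \<in> X" using infinite_imp_nonempty by blast
  with rel show ?thesis
    by (intro Alt_subset_if_cyc3_rel[OF subU, of y]) auto
qed

lemma (in group) conj_pow_closed:
  assumes x: "x \<in> carrier G" and N: "N \<subseteq> carrier G" and conj: "\<And>h. h \<in> N \<Longrightarrow> x \<otimes> h \<otimes> inv x \<in> N"
  shows "h \<in> N \<Longrightarrow> x [^] (n::nat) \<otimes> h \<otimes> inv (x [^] n) \<in> N"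
proof (induction n arbitrary: h)
  case (Suc n)
  have h: "h \<in> carrier G" using Suc.prems N by blast
  have "x [^] Suc n \<otimes> h \<otimes> inv (x [^] Suc n) = x [^] n \<otimes> (x \<otimes> h \<otimes> inv x) \<otimes> inv (x [^] n)"
    using x h by (simp add: m_assoc inv_mult_group)
  then show ?case using Suc.IH[OF conj[OF Suc.prems]] by simp
qed (use N in auto)

text \<open>Powers of \<open>x\<close> can be moved to the right past \<open>N\<close>. Both
  directions of conjugation are demanded because \<open>x\<close> could otherwise conjugate an
  infinite \<open>N\<close> properly into itself, and negative powers need the second
  direction.\<close>

lemma (in group) generate_insert_normalizing:
  assumes N: "subgroup N G" and x: "x \<in> carrier G"
    and conj: "\<And>h. h \<in> N \<Longrightarrow> x \<otimes> h \<otimes> inv x \<in> N" "\<And>h. h \<in> N \<Longrightarrow> inv x \<otimes> h \<otimes> x \<in> N"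
    and p: "p \<in> generate G (insert x N)"
  shows "\<exists>h\<in>N. \<exists>e::int. p = h \<otimes> x [^] e"
proof -
  have sub: "N \<subseteq> carrier G" using N by (rule subgroup.subset)
  have conj_int: "x [^] e \<otimes> h \<otimes> inv (x [^] e) \<in> N" if h: "h \<in> N" for e :: int and h
  proof (cases e rule: int_cases2)
    case (nonneg n)
    then show ?thesis using conj_pow_closed[OF x sub conj(1) h] by (simp add: int_pow_int)
  next
    case (nonpos n)
    have "inv x [^] n \<otimes> h \<otimes> inv (inv x [^] n) \<in> N"
      using x sub conj(2) h by (intro conj_pow_closed) auto
    then show ?thesis using nonpos x by (simp add: int_pow_neg_int nat_pow_inv)
  qed
  show ?thesis
    using p
  proof (induction p rule: generate.induct)
    case one
    then show ?case using subgroup.one_closed[OF N] by (intro bexI[of _ \<one>] exI[of _ 0]) auto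
  next
    case (incl h)
    show ?case
    proof (cases "h = x")
      case True
      then show ?thesis
        using x subgroup.one_closed[OF N] by (intro bexI[of _ \<one>] exI[of _ 1]) auto
    next
      case False
      then show ?thesis using incl sub by (intro bexI[of _ h] exI[of _ 0]) auto
    qed
  next
    case (inv h)
    show ?case
    proof (cases "h = x")
      case True
      then show ?thesis
        using x subgroup.one_closed[OF N]
        by (intro bexI[of _ \<one>] exI[of _ "-1"]) (auto simp: int_pow_neg)
    next
      case False
      then show ?thesis
        using inv sub subgroup.m_inv_closed[OF N] by (intro bexI[of _ "inv h"] exI[of _ 0]) auto
    qed
  next
    case (eng p q)
    then obtain h e k f where *: "h \<in> N" "p = h \<otimes> x [^] (e::int)" "k \<in> N" "q = k \<otimes> x [^] (f::int)"
      by blast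
    have c: "h \<in> carrier G" "k \<in> carrier G" using * sub by auto
    have canc: "inv (x [^] e) \<otimes> (x [^] e \<otimes> x [^] f) = x [^] f"
      using x by (simp flip: m_assoc)
    have "p \<otimes> q = (h \<otimes> (x [^] e \<otimes> k \<otimes> inv (x [^] e))) \<otimes> x [^] (e + f)"
      using c x canc by (simp add: * m_assoc int_pow_mult)
    then show ?case
      using * conj_int subgroup.m_closed[OF N] by blast
  qed
qed

lemma (in group) generate_conj_closed:
  assumes y: "y \<in> carrier G" and S: "S \<subseteq> carrier G"
    and conj: "\<And>s. s \<in> S \<Longrightarrow> y \<otimes> s \<otimes> inv y \<in> generate G S"
    and r: "r \<in> generate G S"
  shows "y \<otimes> r \<otimes> inv y \<in> generate G S"
  using r
proof (induction r rule: generate.induct)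
  case one
  then show ?case using y generate.one by simp
next
  case (incl h)
  then show ?case using conj by blast
next
  case (inv h)
  then have "inv (y \<otimes> h \<otimes> inv y) \<in> generate G S"
    using conj S generate_m_inv_closed by blast
  then show ?case using inv S y by (auto simp: inv_mult_group m_assoc subset_iff)
next
  case (eng p q)
  have "p \<in> carrier G" "q \<in> carrier G" using eng.hyps S generate_in_carrier by auto
  then have "y \<otimes> (p \<otimes> q) \<otimes> inv y = (y \<otimes> p \<otimes> inv y) \<otimes> (y \<otimes> q \<otimes> inv y)"
    using y by (simp add: m_assoc inv_solve_left')
      (metis inv_closed l_inv l_one m_assoc m_closed)
  then show ?case using generate.eng[OF eng.IH] by simp
qed

text \<open>Modulo the normal subgroup \<open>A\<close> the \<open>x i\<close> commute, so that the powers of \<open>x k\<close> can be moved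
  to the end of a word.\<close>

lemma (in group) generate_commuting_mod:
  assumes A: "A \<lhd> G" and x: "\<And>i. i \<in> insert k I \<Longrightarrow> x i \<in> carrier G"
    and comm: "\<And>i j. i \<in> insert k I \<Longrightarrow> j \<in> insert k I \<Longrightarrow> x i \<otimes> x j \<otimes> inv (x i) \<otimes> inv (x j) \<in> A"
    and p: "p \<in> generate G (A \<union> x ` insert k I)"
  shows "\<exists>h\<in>generate G (A \<union> x ` I). \<exists>e::int. p = h \<otimes> x k [^] e"
proof -
  define N where "N = generate G (A \<union> x ` I)"
  have Ac: "A \<subseteq> carrier G" using A by (simp add: normal_def subgroup.subset)
  have Sc: "A \<union> x ` I \<subseteq> carrier G" using Ac x by auto
  have N: "subgroup N G" unfolding N_def by (rule generate_is_subgroup[OF Sc])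
  have AN: "A \<subseteq> N" and xN: "x ` I \<subseteq> N"
    unfolding N_def by (auto intro: generate.incl)
  have xk: "x k \<in> carrier G" using x by simp
  have 1: "x k \<otimes> s \<otimes> inv (x k) \<in> N" if "s \<in> A \<union> x ` I" for s
    using that
  proof
    assume "s \<in> A"
    then show ?thesis using normal.inv_op_closed2[OF A xk] AN by blast
  next
    assume "s \<in> x ` I"
    then have s: "s \<in> carrier G" "s \<in> N" "x k \<otimes> s \<otimes> inv (x k) \<otimes> inv s \<in> N"
      using comm[of k] x AN xN by auto
    have "(x k \<otimes> s \<otimes> inv (x k) \<otimes> inv s) \<otimes> s = x k \<otimes> s \<otimes> inv (x k)"
      using xk s by (simp add: m_assoc)
    then show ?thesis using subgroup.m_closed[OF N s(3,2)] by simp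
  qed
  have 2: "inv (x k) \<otimes> s \<otimes> inv (inv (x k)) \<in> N" if "s \<in> A \<union> x ` I" for s
    using that
  proof
    assume "s \<in> A"
    then show ?thesis using normal.inv_op_closed1[OF A xk] AN xk by auto
  next
    assume "s \<in> x ` I"
    then have s: "s \<in> carrier G" "s \<in> N" "s \<otimes> x k \<otimes> inv s \<otimes> inv (x k) \<in> A"
      using comm[of _ k] x AN xN by auto
    have "inv (x k) \<otimes> (s \<otimes> x k \<otimes> inv s \<otimes> inv (x k)) \<otimes> x k \<in> N"
      using normal.inv_op_closed1[OF A xk s(3)] AN by blast
    moreover have "inv (x k) \<otimes> (s \<otimes> x k \<otimes> inv s \<otimes> inv (x k)) \<otimes> x k \<otimes> s
      = inv (x k) \<otimes> s \<otimes> inv (inv (x k))"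
      using xk s by (simp add: m_assoc)
    ultimately show ?thesis using subgroup.m_closed[OF N _ s(2)] by metis
  qed
  have "generate G (A \<union> x ` insert k I) \<subseteq> generate G (insert (x k) N)"
    using AN xN by (intro mono_generate) auto
  then have "p \<in> generate G (insert (x k) N)" using p by blast
  moreover have "x k \<otimes> h \<otimes> inv (x k) \<in> N" if "h \<in> N" for h
    using generate_conj_closed[OF xk Sc] 1 that by (simp add: N_def)
  moreover have "inv (x k) \<otimes> h \<otimes> x k \<in> N" if "h \<in> N" for h
    using generate_conj_closed[OF inv_closed[OF xk] Sc] 2 that xk by (simp add: N_def)
  ultimately show ?thesis
    using generate_insert_normalizing[OF N xk] by (simp add: N_def)
qed

section \<open>Eventual translations\<close>

text \<open>Truncation by \<open>nat\<close> affects only finitely many \<open>m\<close>, so under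
  the eventual quantifier this is a true translation by a possibly negative integer.\<close>

definition translates :: "(nat \<times> nat \<Rightarrow> nat \<times> nat) \<Rightarrow> nat \<Rightarrow> int \<Rightarrow> bool"
  where "translates p i t \<longleftrightarrow> (\<forall>\<^sub>F m in sequentially. p (i, m) = (i, nat (int m + t)))"

lemma filterlim_nat_add: "filterlim (\<lambda>m. nat (int m + t)) sequentially sequentially"
  unfolding filterlim_at_top
proof
  fix Z :: nat
  show "\<forall>\<^sub>F m in sequentially. Z \<le> nat (int m + t)"
    by (rule eventually_sequentiallyI[of "Z + nat \<bar>t\<bar>"]) linarith
qed

lemma translates_unique:
  assumes "translates p i s" "translates p i t"
  shows "s = t"
proof -
  have "\<forall>\<^sub>F m in sequentially. p (i, m) = (i, nat (int m + s)) \<and> p (i, m) = (i, nat (int m + t))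
      \<and> m \<ge> nat \<bar>s\<bar> + nat \<bar>t\<bar>"
    using assms unfolding translates_def
    by (intro eventually_conj eventually_ge_at_top)
  then obtain m where "nat (int m + s) = nat (int m + t)" "m \<ge> nat \<bar>s\<bar> + nat \<bar>t\<bar>"
    using eventually_happens'[OF sequentially_bot] by fastforce
  then show ?thesis by linarith
qed

lemma translates_comp:
  assumes "translates p i s" "translates q i t"
  shows "translates (q \<circ> p) i (s + t)"
proof -
  have "\<forall>\<^sub>F m in sequentially. q (i, nat (int m + s)) = (i, nat (int (nat (int m + s)) + t))"
    using eventually_compose_filterlim[OF assms(2)[unfolded translates_def] filterlim_nat_add] .
  moreover have "\<forall>\<^sub>F m in sequentially. p (i, m) = (i, nat (int m + s))"
    using assms(1) by (simp add: translates_def)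
  moreover have "\<forall>\<^sub>F m in sequentially. m \<ge> nat \<bar>s\<bar>" by (rule eventually_ge_at_top)
  ultimately show ?thesis
    unfolding translates_def by eventually_elim (auto simp: algebra_simps)
qed

lemma translates_inv:
  assumes "bij p" "translates p i t"
  shows "translates (inv' p) i (- t)"
proof -
  have "\<forall>\<^sub>F m in sequentially. p (i, nat (int m + - t)) = (i, nat (int (nat (int m + - t)) + t))"
    using eventually_compose_filterlim[OF assms(2)[unfolded translates_def] filterlim_nat_add] .
  moreover have "\<forall>\<^sub>F m in sequentially. m \<ge> nat \<bar>t\<bar> + 1" by (rule eventually_ge_at_top)
  ultimately show ?thesis
    unfolding translates_def
  proof eventually_elim
    case (elim m)
    then have "p (i, nat (int m + - t)) = (i, m)" by (simp add: nat_eq_iff)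
    then show ?case using assms(1) by (metis bij_inv_eq_iff)
  qed
qed

lemma translates_id: "translates id i 0"
  by (simp add: translates_def)

lemma translates_finite_support:
  assumes "finite {x. p x \<noteq> x}"
  shows "translates p i 0"
proof -
  have "finite (snd ` {x. p x \<noteq> x})" using assms by simp
  then obtain M where M: "\<And>x. p x \<noteq> x \<Longrightarrow> snd x < M"
    by (metis (mono_tags, lifting) finite_nat_set_iff_bounded image_eqI mem_Collect_eq)
  show ?thesis unfolding translates_def
    by (rule eventually_sequentiallyI[of M]) (use M in force)
qed

lemma translates_houghton_gen:
  assumes "k \<noteq> 1"
  shows "translates (houghton_gen k) i (if i = 1 then 1 else if i = k then -1 else 0)"
  unfolding translates_def
  by (rule eventually_sequentiallyI[of 2]) (use assms in \<open>auto simp: houghton_gen_def\<close>)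

text \<open>For \<open>n \<ge> 3\<close> this is the familiar description of the Houghton group by
  eventual translations; here it is the ambient group on which shifts exist and are
  additive.\<close>

definition ends :: "nat \<Rightarrow> (nat \<times> nat \<Rightarrow> nat \<times> nat) set"
  where "ends n = {p. p permutes ray_space n \<and> (\<forall>i\<in>{1..n}. \<exists>t. translates p i t)}"

definition shift :: "(nat \<times> nat \<Rightarrow> nat \<times> nat) \<Rightarrow> nat \<Rightarrow> int"
  where "shift p i = (THE t. translates p i t)"

lemma shift_eqI: "translates p i t \<Longrightarrow> shift p i = t"
  unfolding shift_def using translates_unique by blast

lemma translates_shift: "p \<in> ends n \<Longrightarrow> i \<in> {1..n} \<Longrightarrow> translates p i (shift p i)"
  using shift_eqI by (force simp: ends_def)

lemma ends_bij: "p \<in> ends n \<Longrightarrow> bij p"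
  by (auto simp: ends_def permutes_bij)

lemma subgroup_ends: "subgroup (ends n) (Sym (ray_space n))"
proof (rule group.subgroupI[OF group_Sym])
  show "ends n \<subseteq> carrier (Sym (ray_space n))" by (auto simp: ends_def)
  have "id \<in> ends n" by (auto simp: ends_def permutes_id intro: translates_id)
  then show "ends n \<noteq> {}" by blast
next
  fix p assume p: "p \<in> ends n"
  then have "inv' p \<in> ends n"
    using translates_inv[OF ends_bij[OF p]] by (force simp: ends_def permutes_inv)
  then show "inv\<^bsub>Sym (ray_space n)\<^esub> p \<in> ends n"
    using p by (simp add: ends_def inv_Sym)
next
  fix p q assume "p \<in> ends n" "q \<in> ends n"
  then show "p \<otimes>\<^bsub>Sym (ray_space n)\<^esub> q \<in> ends n"
    using translates_comp by (fastforce simp: ends_def permutes_compose)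
qed

lemma shift_comp: "p \<in> ends n \<Longrightarrow> q \<in> ends n \<Longrightarrow> i \<in> {1..n} \<Longrightarrow> shift (p \<circ> q) i = shift p i + shift q i"
  using shift_eqI[OF translates_comp[OF translates_shift translates_shift]] by simp

lemma shift_inv: "p \<in> ends n \<Longrightarrow> i \<in> {1..n} \<Longrightarrow> shift (inv' p) i = - shift p i"
  using shift_eqI[OF translates_inv[OF ends_bij translates_shift]] by simp

lemma shift_id: "shift id i = 0"
  by (rule shift_eqI[OF translates_id])

lemma shift_houghton_gen:
  "k \<noteq> 1 \<Longrightarrow> shift (houghton_gen k) i = (if i = 1 then 1 else if i = k then -1 else 0)"
  by (rule shift_eqI[OF translates_houghton_gen])

lemma houghton_gen_permutes: "k \<in> {2..n} \<Longrightarrow> houghton_gen k permutes ray_space n"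
  using houghton_gen_in_Sym by simp

lemma houghton_gen_in_ends: "k \<in> {2..n} \<Longrightarrow> houghton_gen k \<in> ends n"
  using translates_houghton_gen[of k] by (force simp: ends_def houghton_gen_permutes)

lemma FSym_subset_ends: "FSym (ray_space n) \<subseteq> ends n"
  using translates_finite_support by (auto simp: FSym_def ends_def)

lemma Alt_subset_FSym: "Alt X \<subseteq> FSym X"
  by (auto simp: Alt_def)

lemma shift_FSym: "p \<in> FSym X \<Longrightarrow> shift p i = 0"
  by (intro shift_eqI translates_finite_support) (simp add: FSym_def)

lemma FSym_if_shift_zero:
  assumes p: "p \<in> ends n" and zero: "\<And>i. i \<in> {1..n} \<Longrightarrow> shift p i = 0"
  shows "p \<in> FSym (ray_space n)"
proof -
  have "\<exists>M. \<forall>m\<ge>M. p (i, m) = (i, m)" if "i \<in> {1..n}" for i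
    using translates_shift[OF p that] zero[OF that] by (simp add: translates_def eventually_sequentially)
  then obtain M where M: "\<And>i m. i \<in> {1..n} \<Longrightarrow> m \<ge> M i \<Longrightarrow> p (i, m) = (i, m)"
    by metis
  have "{x. p x \<noteq> x} \<subseteq> (SIGMA i:{1..n}. {..<M i})"
  proof
    fix x assume x: "x \<in> {x. p x \<noteq> x}"
    then have "x \<in> ray_space n" using p permutes_not_in[of p "ray_space n" x] by (auto simp: ends_def)
    then show "x \<in> (SIGMA i:{1..n}. {..<M i})"
      using x M[of "fst x" "snd x"] by (force simp: ray_space_def not_less[symmetric])
  qed
  moreover have "finite (SIGMA i:{1..n}. {..<M i})" by auto
  ultimately have "finite {x. p x \<noteq> x}" by (rule finite_subset)
  then show ?thesis using p by (simp add: FSym_def ends_def)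
qed

lemma Sym_nat_pow: "p [^]\<^bsub>Sym X\<^esub> (N::nat) = p ^^ N"
  by (induction N) (simp_all add: nat_pow_def)

lemma shift_funpow: "p \<in> ends n \<Longrightarrow> i \<in> {1..n} \<Longrightarrow> shift (p ^^ N) i = int N * shift p i"
proof (induction N)
  case (Suc N)
  then show ?case
    using shift_comp[of p n "p ^^ N" i] subgroup_Sym_funpow[OF subgroup_ends, of p n N]
    by (simp add: algebra_simps o_def)
qed (simp add: shift_id)

lemma shift_int_pow:
  assumes "p \<in> ends n" "i \<in> {1..n}"
  shows "shift (p [^]\<^bsub>Sym (ray_space n)\<^esub> (e::int)) i = e * shift p i"
proof -
  interpret group "Sym (ray_space n)" by (rule group_Sym)
  have p: "p permutes ray_space n" using assms by (simp add: ends_def)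
  show ?thesis
  proof (cases e rule: int_cases2)
    case (nonneg N)
    then show ?thesis using shift_funpow[OF assms] by (simp add: int_pow_int Sym_nat_pow)
  next
    case (nonpos N)
    have N: "p ^^ N \<in> ends n" by (rule subgroup_Sym_funpow[OF subgroup_ends assms(1)])
    then have "(p ^^ N) permutes ray_space n" by (simp add: ends_def)
    then have "p [^]\<^bsub>Sym (ray_space n)\<^esub> e = inv' (p ^^ N)"
      using nonpos p by (simp add: int_pow_neg_int Sym_nat_pow inv_Sym)
    then show ?thesis
      using nonpos shift_inv[OF N assms(2)] shift_funpow[OF assms] by simp
  qed
qed

lemma subgroup_shift_kernel:
  assumes "k \<in> {1..n}"
  shows "subgroup {p \<in> ends n. shift p k = 0} (Sym (ray_space n))"
proof (rule group.subgroupI[OF group_Sym])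
  show "{p \<in> ends n. shift p k = 0} \<noteq> {}"
    using subgroup_Sym_id[OF subgroup_ends] shift_id by blast
next
  fix p assume "p \<in> {p \<in> ends n. shift p k = 0}"
  then show "inv\<^bsub>Sym (ray_space n)\<^esub> p \<in> {p \<in> ends n. shift p k = 0}"
    using assms subgroup_Sym_inv[OF subgroup_ends] shift_inv[of p n k]
    by (auto simp: inv_Sym ends_def)
qed (use assms subgroup_Sym_comp[OF subgroup_ends] shift_comp in \<open>auto simp: ends_def\<close>)

section \<open>Parity and commutators\<close>

lemma conj_comp: "bij g \<Longrightarrow> g \<circ> (p \<circ> q) \<circ> inv' g = (g \<circ> p \<circ> inv' g) \<circ> (g \<circ> q \<circ> inv' g)"
  by (simp add: fun_eq_iff bij_is_inj)

lemma conj_transpose: "bij g \<Longrightarrow> g \<circ> transpose a b \<circ> inv' g = transpose (g a) (g b)"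
  by (auto simp: fun_eq_iff transpose_def bij_is_surj surj_f_inv_f inj_eq bij_is_inj)

text \<open>The support of \<open>g\<close> may be infinite, where \<open>evenperm g\<close> is
  meaningless, so parities cannot simply be multiplied; conjugation is followed through a product of
  transpositions instead.\<close>

lemma evenperm_conj:
  assumes g: "bij g" and p: "permutation p"
  shows "permutation (g \<circ> p \<circ> inv' g) \<and> (evenperm (g \<circ> p \<circ> inv' g) \<longleftrightarrow> evenperm p)"
proof -
  obtain S where S: "finite S" "p permutes S"
    using p permutation_permutes by blast
  from S(2,1) show ?thesis
  proof (induction rule: permutes_induct)
    case id
    have "g \<circ> id \<circ> inv' g = id" using g by (simp add: fun_eq_iff bij_is_surj surj_f_inv_f)
    then show ?case by simp
  next
    case (swap a b p)
    define q where "q = g \<circ> p \<circ> inv' g"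
    have q: "permutation q" "evenperm q \<longleftrightarrow> evenperm p"
      using swap.IH by (simp_all only: q_def)
    have p: "permutation p" using swap S(1) permutation_permutes by blast
    have gab: "g a = g b \<longleftrightarrow> a = b" using g by (simp add: bij_is_inj inj_eq)
    have "g \<circ> (transpose a b \<circ> p) \<circ> inv' g = transpose (g a) (g b) \<circ> q"
      by (simp only: q_def conj_comp[OF g] conj_transpose[OF g])
    moreover have "permutation (transpose (g a) (g b) \<circ> q)"
      by (rule permutation_compose[OF permutation_swap_id q(1)])
    moreover have "evenperm (transpose (g a) (g b) \<circ> q) \<longleftrightarrow> evenperm (transpose a b \<circ> p)"
      using q(2) gab
      by (simp only: evenperm_comp[OF permutation_swap_id q(1)] evenperm_comp[OF permutation_swap_id p] evenperm_swap)
    ultimately show ?case by (simp only:)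
  qed
qed

lemma conj_in_FSym:
  assumes "g permutes X" "p \<in> FSym X"
  shows "g \<circ> p \<circ> inv' g \<in> FSym X"
  using evenperm_conj[OF permutes_bij[OF assms(1)] permutation_of_FSym[OF assms(2)]] assms
  by (auto simp: FSym_def permutation intro!: permutes_compose permutes_inv)

lemma conj_in_Alt:
  assumes "g permutes X" "p \<in> Alt X"
  shows "g \<circ> p \<circ> inv' g \<in> Alt X"
  using evenperm_conj[OF permutes_bij[OF assms(1)] permutation_of_FSym] assms conj_in_FSym[OF assms(1)]
  by (auto simp: Alt_def)

lemma normal_if_conj_closed:
  assumes A: "subgroup A (Sym X)" and conj: "\<And>g p. g permutes X \<Longrightarrow> p \<in> A \<Longrightarrow> g \<circ> p \<circ> inv' g \<in> A"
  shows "A \<lhd> Sym X"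
proof (rule group.normal_invI[OF group_Sym A])
  fix g p assume "g \<in> carrier (Sym X)" "p \<in> A"
  then show "g \<otimes>\<^bsub>Sym X\<^esub> p \<otimes>\<^bsub>Sym X\<^esub> inv\<^bsub>Sym X\<^esub> g \<in> A"
    using conj[of "inv' g" p] permutes_inv[of g X] by (simp add: inv_Sym permutes_inv_inv o_assoc)
qed

lemma normal_FSym: "FSym X \<lhd> Sym X"
  by (rule normal_if_conj_closed[OF subgroup_FSym conj_in_FSym])

lemma normal_Alt: "Alt X \<lhd> Sym X"
  by (rule normal_if_conj_closed[OF subgroup_Alt conj_in_Alt])

definition commutator :: "('a \<Rightarrow> 'a) \<Rightarrow> ('a \<Rightarrow> 'a) \<Rightarrow> 'a \<Rightarrow> 'a"
  where "commutator g h = g \<circ> h \<circ> inv' g \<circ> inv' h"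

lemma inv_commutator: "bij g \<Longrightarrow> bij h \<Longrightarrow> inv' (commutator g h) = commutator h g"
  by (auto simp: commutator_def o_inv_distrib bij_comp bij_imp_bij_inv inv_inv_eq fun_eq_iff)

text \<open>\<open>[g\<^sup>2, h] = (g [g, h] g\<^sup>-\<^sup>1) [g, h]\<close> is a product of two permutations of equal parity.\<close>

lemma commutator_square_in_Alt:
  assumes g: "g permutes X" and h: "h permutes X" and c: "commutator g h \<in> FSym X"
  shows "commutator (g \<circ> g) h \<in> Alt X"
proof -
  define c where "c = commutator g h"
  have bij: "bij g" "bij h" using g h permutes_bij by auto
  have 1: "permutation c" "c \<in> FSym X"
    using c permutation_of_FSym unfolding c_def by blast+
  note 2 = evenperm_conj[OF bij(1) 1(1)]
  have "commutator (g \<circ> g) h = (g \<circ> c \<circ> inv' g) \<circ> c"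
    using bij by (simp add: c_def commutator_def fun_eq_iff o_inv_distrib bij_is_inj bij_is_surj surj_f_inv_f)
  moreover have "evenperm ((g \<circ> c \<circ> inv' g) \<circ> c)"
    using 1 2 by (subst evenperm_comp) auto
  ultimately show ?thesis
    using FSym_comp[OF conj_in_FSym[OF g 1(2)] 1(2)] by (simp add: Alt_def)
qed

text \<open>The squaring step treats one entry of the commutator; inversion swaps the entries, and
  the step is applied again to the other one.\<close>

lemma commutator_squares_in_Alt:
  assumes g: "g permutes X" and h: "h permutes X" and c: "commutator g h \<in> FSym X"
  shows "commutator (g \<circ> g) (h \<circ> h) \<in> Alt X"
proof -
  have bij: "bij g" "bij h" using g h permutes_bij by auto
  have gg: "(g \<circ> g) permutes X" using g permutes_compose by blast
  have "inv' (commutator (g \<circ> g) h) \<in> Alt X"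
    by (rule Alt_inv[OF commutator_square_in_Alt[OF g h c]])
  then have "commutator h (g \<circ> g) \<in> FSym X"
    using Alt_subset_FSym bij by (auto simp: inv_commutator bij_comp)
  then have "inv' (commutator (h \<circ> h) (g \<circ> g)) \<in> Alt X"
    by (intro Alt_inv commutator_square_in_Alt[OF h gg])
  then show ?thesis using bij by (simp add: inv_commutator bij_comp)
qed

lemma commutator_ends_in_FSym:
  assumes g: "g \<in> ends n" and h: "h \<in> ends n"
  shows "commutator g h \<in> FSym (ray_space n)"
proof (rule FSym_if_shift_zero)
  note comp = subgroup_Sym_comp[OF subgroup_ends] and inv = subgroup_Sym_inv[OF subgroup_ends]
  show "commutator g h \<in> ends n"
    unfolding commutator_def using g h by (intro comp inv)
  show "shift (commutator g h) i = 0" if "i \<in> {1..n}" for i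
    unfolding commutator_def using g h that comp inv
    by (simp add: shift_comp[of _ n] shift_inv[of _ n])
qed

lemma shift_zero_if_generated:
  assumes A: "A \<subseteq> FSym (ray_space n)" and "k \<in> {1..n}"
    and "\<And>i. i \<in> I \<Longrightarrow> x i \<in> ends n" "\<And>i. i \<in> I \<Longrightarrow> shift (x i) k = 0"
    and p: "p \<in> generate (Sym (ray_space n)) (A \<union> x ` I)"
  shows "p \<in> ends n \<and> shift p k = 0"
proof -
  have "A \<union> x ` I \<subseteq> {p \<in> ends n. shift p k = 0}"
    using assms FSym_subset_ends shift_FSym by blast
  then show ?thesis
    using group.generate_subgroup_incl[OF group_Sym _ subgroup_shift_kernel[OF assms(2)]] p by blast
qed

text \<open>Generators are peeled off from the highest index down: modulo \<open>A\<close> they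
  commute, so \<open>p\<close> is a word in the lower ones times a power of \<open>x k\<close>, and
  the exponent vanishes because only \<open>x k\<close> shifts ray \<open>k\<close>. Arguing with
  words rather than supports gives membership in \<open>A\<close> itself, which for
  \<open>A = Alt (ray_space n)\<close> includes the parity.\<close>

lemma shift_kernel:
  assumes A: "A \<lhd> Sym (ray_space n)" "A \<subseteq> FSym (ray_space n)"
    and x: "\<And>k. k \<in> {2..n} \<Longrightarrow> x k \<in> ends n"
    and diag: "\<And>k. k \<in> {2..n} \<Longrightarrow> shift (x k) k \<noteq> 0"
    and off: "\<And>j k. j \<in> {2..n} \<Longrightarrow> k \<in> {2..n} \<Longrightarrow> j \<noteq> k \<Longrightarrow> shift (x j) k = 0"
    and comm: "\<And>j k. j \<in> {2..n} \<Longrightarrow> k \<in> {2..n} \<Longrightarrow> commutator (inv' (x j)) (inv' (x k)) \<in> A"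
    and p: "p \<in> generate (Sym (ray_space n)) (A \<union> x ` {2..n})"
    and zero: "\<And>k. k \<in> {2..n} \<Longrightarrow> shift p k = 0"
  shows "p \<in> A"
proof -
  let ?G = "Sym (ray_space n)"
  interpret group ?G by (rule group_Sym)
  have subA: "subgroup A ?G" using A(1) by (rule normal_imp_subgroup)
  have "p \<in> A" if "p \<in> generate ?G (A \<union> x ` {2..m})" "m \<le> n" "\<And>k. k \<in> {2..n} \<Longrightarrow> shift p k = 0" for m p
    using that
  proof (induction m arbitrary: p)
    case 0
    then show ?case using generate_subgroup_incl[OF _ subA, of A] by auto
  next
    case (Suc m)
    show ?case
    proof (cases "m = 0")
      case True
      then show ?thesis using Suc.prems(1) generate_subgroup_incl[OF _ subA, of A] by auto
    next
      case False
      let ?k = "Suc m"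
      have k: "?k \<in> {2..n}" and k1: "?k \<in> {1..n}" and ins: "{2..Suc m} = insert ?k {2..m}"
        using False Suc.prems(2) by auto
      have xp: "x i permutes ray_space n" if "i \<in> insert ?k {2..m}" for i
        using x[of i] that k by (auto simp: ends_def)
      have "x i \<otimes>\<^bsub>?G\<^esub> x j \<otimes>\<^bsub>?G\<^esub> inv\<^bsub>?G\<^esub> (x i) \<otimes>\<^bsub>?G\<^esub> inv\<^bsub>?G\<^esub> (x j) \<in> A"
        if ij: "i \<in> insert ?k {2..m}" "j \<in> insert ?k {2..m}" for i j
      proof -
        have ij': "i \<in> {2..n}" "j \<in> {2..n}" using ij k by auto
        have i: "x i permutes ray_space n" and j: "x j permutes ray_space n" using ij xp by auto
        \<comment> \<open>The group multiplies from left to right, so its commutators become, in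
          terms of \<open>\<circ>\<close>, commutators of inverses.\<close>
        have "commutator (inv' (x j)) (inv' (x i)) = inv' (x j) \<circ> inv' (x i) \<circ> x j \<circ> x i"
          using i j by (simp add: commutator_def permutes_bij inv_inv_eq)
        then show ?thesis
          using comm[OF ij'(2,1)] i j by (simp add: inv_Sym o_assoc)
      qed
      then obtain h e where h: "h \<in> generate ?G (A \<union> x ` {2..m})" and p: "p = h \<otimes>\<^bsub>?G\<^esub> x ?k [^]\<^bsub>?G\<^esub> (e::int)"
        using generate_commuting_mod[OF A(1), of ?k "{2..m}" x p] Suc.prems(1) xp unfolding ins by auto
      have hz: "h \<in> ends n \<and> shift h ?k = 0"
        by (rule shift_zero_if_generated[OF A(2) k1 _ _ h]) (use x off k in auto)
      have xe: "x ?k [^]\<^bsub>?G\<^esub> e \<in> ends n"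
        using subgroup_int_pow_closed[OF subgroup_ends x[OF k]] .
      have "shift p ?k = e * shift (x ?k) ?k"
        using hz shift_comp[OF xe _ k1] shift_int_pow[OF x[OF k] k1] by (simp add: p)
      then have "e = 0" using Suc.prems(3)[OF k] diag[OF k] by simp
      then have "p = h" using p by (simp add: int_pow_0)
      then show ?thesis using Suc.IH h Suc.prems by simp
    qed
  qed
  then show ?thesis using p zero by blast
qed

section \<open>The Houghton groups\<close>

abbreviation (input) ray_Sym :: "nat \<Rightarrow> (nat \<times> nat \<Rightarrow> nat \<times> nat) monoid"
  where "ray_Sym n \<equiv> Sym (ray_space n)"

lemma funpow_2: "f ^^ 2 = f \<circ> f"
  by (simp add: numeral_2_eq_2)

lemma carrier_houghton: "carrier (houghton n) = generate (ray_Sym n) (houghton_gen ` {2..n})"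
proof -
  have "carrier (ray_Sym n) \<inter> houghton_gen ` {2..n} = houghton_gen ` {2..n}"
    using houghton_gen_permutes by auto
  then show ?thesis by (simp add: houghton_def carrier_subgroup_generated)
qed

lemma carrier_houghton_G2:
  "carrier (houghton_G2 n)
    = generate (ray_Sym n) (Alt (ray_space n) \<union> (\<lambda>k. houghton_gen k ^^ 2) ` {2..n})"
proof -
  have "(houghton_gen k ^^ 2) permutes ray_space n" if "k \<in> {2..n}" for k
    unfolding funpow_2 using houghton_gen_permutes[OF that] by (intro permutes_compose)
  then have "carrier (ray_Sym n) \<inter> (Alt (ray_space n) \<union> (\<lambda>k. houghton_gen k ^^ 2) ` {2..n})
    = Alt (ray_space n) \<union> (\<lambda>k. houghton_gen k ^^ 2) ` {2..n}"
    using Alt_subset_Sym by auto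
  then show ?thesis by (simp add: houghton_G2_def carrier_subgroup_generated Sym_nat_pow)
qed

lemma houghton_eq: "houghton n = (ray_Sym n)\<lparr>carrier := carrier (houghton n)\<rparr>"
  by (simp add: houghton_def subgroup_generated_def)

lemma houghton_G2_eq: "houghton_G2 n = (ray_Sym n)\<lparr>carrier := carrier (houghton_G2 n)\<rparr>"
  by (simp add: houghton_G2_def subgroup_generated_def)

lemma subgroup_houghton: "subgroup (carrier (houghton n)) (ray_Sym n)"
  unfolding carrier_houghton
  by (rule group.generate_is_subgroup[OF group_Sym]) (use houghton_gen_permutes in auto)

lemma houghton_gen_sq_in_ends: "k \<in> {2..n} \<Longrightarrow> houghton_gen k ^^ 2 \<in> ends n"
  by (rule subgroup_Sym_funpow[OF subgroup_ends houghton_gen_in_ends])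

lemma subgroup_houghton_G2: "subgroup (carrier (houghton_G2 n)) (ray_Sym n)"
  unfolding carrier_houghton_G2
  by (rule group.generate_is_subgroup[OF group_Sym])
    (use houghton_gen_sq_in_ends subgroup.subset[OF subgroup_ends] Alt_subset_Sym in blast)

lemma houghton_gen_in_houghton: "k \<in> {2..n} \<Longrightarrow> houghton_gen k \<in> carrier (houghton n)"
  unfolding carrier_houghton by (auto intro: generate.incl)

lemma houghton_gen_sq_in_G2: "k \<in> {2..n} \<Longrightarrow> houghton_gen k ^^ 2 \<in> carrier (houghton_G2 n)"
  unfolding carrier_houghton_G2 by (auto intro: generate.incl)

lemma Alt_subset_G2: "Alt (ray_space n) \<subseteq> carrier (houghton_G2 n)"
  unfolding carrier_houghton_G2 by (auto intro: generate.incl)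

lemma houghton_subset_ends: "carrier (houghton n) \<subseteq> ends n"
  unfolding carrier_houghton
  by (rule group.generate_subgroup_incl[OF group_Sym _ subgroup_ends])
    (use houghton_gen_in_ends in auto)

lemma G2_subset_ends: "carrier (houghton_G2 n) \<subseteq> ends n"
  unfolding carrier_houghton_G2
  by (rule group.generate_subgroup_incl[OF group_Sym _ subgroup_ends])
    (use houghton_gen_sq_in_ends Alt_subset_FSym FSym_subset_ends in blast)

lemma shift_houghton_gen_funpow:
  assumes "j \<in> {2..n}" "k \<in> {2..n}"
  shows "shift (houghton_gen j ^^ N) k = (if j = k then - int N else 0)"
  using assms shift_funpow[OF houghton_gen_in_ends[OF assms(1)], of k N]
  by (auto simp: shift_houghton_gen)

lemma houghton_kernel:
  assumes "p \<in> carrier (houghton n)" "\<And>k. k \<in> {2..n} \<Longrightarrow> shift p k = 0"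
  shows "p \<in> FSym (ray_space n)"
proof (rule shift_kernel[OF normal_FSym, where x = houghton_gen])
  show "commutator (inv' (houghton_gen j)) (inv' (houghton_gen k)) \<in> FSym (ray_space n)"
    if "j \<in> {2..n}" "k \<in> {2..n}" for j k
    using that
    by (intro commutator_ends_in_FSym subgroup_Sym_inv[OF subgroup_ends] houghton_gen_in_ends)
  show "p \<in> generate (ray_Sym n) (FSym (ray_space n) \<union> houghton_gen ` {2..n})"
    using assms(1) group.mono_generate[OF group_Sym, of "houghton_gen ` {2..n}"]
    unfolding carrier_houghton by blast
qed (use assms houghton_gen_in_ends in \<open>auto simp: shift_houghton_gen\<close>)

lemma G2_kernel:
  assumes "p \<in> carrier (houghton_G2 n)" "\<And>k. k \<in> {2..n} \<Longrightarrow> shift p k = 0"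
  shows "p \<in> Alt (ray_space n)"
proof (rule shift_kernel[OF normal_Alt Alt_subset_FSym, where x = "\<lambda>k. houghton_gen k ^^ 2"])
  show "commutator (inv' (houghton_gen j ^^ 2)) (inv' (houghton_gen k ^^ 2)) \<in> Alt (ray_space n)"
    if jk: "j \<in> {2..n}" "k \<in> {2..n}" for j k
  proof -
    have "inv' (houghton_gen j) \<in> ends n" "inv' (houghton_gen k) \<in> ends n"
      using jk houghton_gen_in_ends subgroup_Sym_inv[OF subgroup_ends] by auto
    then have "commutator (inv' (houghton_gen j) \<circ> inv' (houghton_gen j))
        (inv' (houghton_gen k) \<circ> inv' (houghton_gen k)) \<in> Alt (ray_space n)"
      using commutator_squares_in_Alt commutator_ends_in_FSym by (force simp: ends_def)
    then show ?thesis
      using jk[THEN houghton_gen_permutes, THEN permutes_bij] by (simp add: funpow_2 o_inv_distrib)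
  qed
qed (use assms in \<open>auto simp: houghton_gen_sq_in_ends shift_houghton_gen_funpow carrier_houghton_G2\<close>)

text \<open>Ensures that the power of \<open>houghton_gen 2\<close> with the same shift on ray 2 as
  a given element is a power of its square, hence lies in \<open>G\<^sub>2\<close>.\<close>

lemma even_shift_G2:
  assumes p: "p \<in> carrier (houghton_G2 n)" and k: "k \<in> {2..n}"
  shows "even (shift p k)"
proof -
  have k1: "k \<in> {1..n}" using k by auto
  have sub: "subgroup {p \<in> ends n. even (shift p k)} (ray_Sym n)"
  proof (rule group.subgroupI[OF group_Sym])
    show "{p \<in> ends n. even (shift p k)} \<noteq> {}"
      using subgroup_Sym_id[OF subgroup_ends] shift_id by force
  next
    fix p assume "p \<in> {p \<in> ends n. even (shift p k)}"
    then show "inv\<^bsub>ray_Sym n\<^esub> p \<in> {p \<in> ends n. even (shift p k)}"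
      using k1 subgroup_Sym_inv[OF subgroup_ends] shift_inv[of p n k]
      by (auto simp: inv_Sym ends_def)
  qed (use k1 subgroup_Sym_comp[OF subgroup_ends] shift_comp in \<open>auto simp: ends_def\<close>)
  have "Alt (ray_space n) \<union> (\<lambda>k. houghton_gen k ^^ 2) ` {2..n} \<subseteq> {p \<in> ends n. even (shift p k)}"
    using Alt_subset_FSym[of "ray_space n"] FSym_subset_ends[of n] shift_FSym houghton_gen_sq_in_ends k
    by (auto simp: shift_houghton_gen_funpow)
  from group.generate_subgroup_incl[OF group_Sym this sub] show ?thesis
    using p unfolding carrier_houghton_G2 by blast
qed

lemma G2_realizes_even_shifts:
  "\<exists>p\<in>carrier (houghton_G2 n). \<forall>k\<in>{2..n}. shift p k = 2 * f k"
proof -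
  note G2 = subgroup_houghton_G2[of n]
  have "\<exists>p\<in>carrier (houghton_G2 n). \<forall>k\<in>{2..n}. shift p k = (if k \<le> m then 2 * f k else 0)" for m
  proof (induction m)
    case 0
    show ?case by (rule bexI[OF _ subgroup_Sym_id[OF G2]]) (simp add: shift_id del: id_apply)
  next
    case (Suc m)
    then obtain p where p: "p \<in> carrier (houghton_G2 n)"
      "\<forall>k\<in>{2..n}. shift p k = (if k \<le> m then 2 * f k else 0)" by blast
    show ?case
    proof (cases "Suc m \<in> {2..n}")
      case False
      then show ?thesis using p by (intro bexI[of _ p]) (auto simp: le_Suc_eq)
    next
      case True
      let ?g = "houghton_gen (Suc m) ^^ 2"
      \<comment> \<open>The exponent is negated because \<open>?g\<close> shifts ray
        \<open>Suc m\<close> by -2.\<close>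
      let ?x = "?g [^]\<^bsub>ray_Sym n\<^esub> (- f (Suc m))"
      have x: "?x \<in> carrier (houghton_G2 n)"
        using group.subgroup_int_pow_closed[OF group_Sym G2 houghton_gen_sq_in_G2[OF True]] .
      have "shift (p \<circ> ?x) k = (if k \<le> Suc m then 2 * f k else 0)" if k: "k \<in> {2..n}" for k
      proof -
        have k1: "k \<in> {1..n}" using k by simp
        have e: "p \<in> ends n" "?x \<in> ends n" using p(1) x G2_subset_ends by blast+
        have "shift (p \<circ> ?x) k = shift p k + (- f (Suc m)) * shift ?g k"
          using shift_comp[OF e k1] shift_int_pow[OF houghton_gen_sq_in_ends[OF True] k1] by simp
        then show ?thesis
          using p(2) k shift_houghton_gen_funpow[OF True k] by (cases "k = Suc m") auto
      qed
      then show ?thesis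
        using subgroup_Sym_comp[OF G2 p(1) x] by blast
    qed
  qed
  from this[of n] show ?thesis by auto
qed

section \<open>Powers of a generator and 3-cycles in the Houghton group\<close>

lemma houghton_gen_funpow_1: "m \<ge> 1 \<Longrightarrow> (houghton_gen k ^^ N) (1, m) = (1, m + N)"
  by (induction N) (auto simp: houghton_gen_def)

lemma houghton_gen_funpow_k:
  "k \<noteq> 1 \<Longrightarrow> m \<ge> 1 \<Longrightarrow> (houghton_gen k ^^ N) (k, m) = (if N < m then (k, m - N) else (1, N - m + 1))"
  by (induction N) (auto simp: houghton_gen_def Suc_diff_le)

lemma houghton_gen_funpow_fix:
  "m = 0 \<or> i \<noteq> 1 \<and> i \<noteq> k \<Longrightarrow> (houghton_gen k ^^ N) (i, m) = (i, m)"
  by (induction N) (auto simp: houghton_gen_def)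

lemma houghton_gen_funpow_fixed_points:
  assumes "k \<noteq> 1" "N \<ge> 1"
  shows "(houghton_gen k ^^ N) (i, m) = (i, m) \<longleftrightarrow> m = 0 \<or> i \<noteq> 1 \<and> i \<noteq> k"
  using assms houghton_gen_funpow_1[of m N k] houghton_gen_funpow_k[of k m N]
    houghton_gen_funpow_fix[of m i k N]
  by (cases "m = 0"; cases "i = 1"; cases "i = k") (auto split: if_splits)

lemma houghton_gen_funpow_wanders:
  assumes k: "k \<noteq> 1" and a: "a = houghton_gen k ^^ \<alpha>" "\<alpha> \<ge> 1" and D: "finite D"
  shows "\<exists>N. \<forall>x\<in>D. a x \<noteq> x \<longrightarrow> (a ^^ N) x \<notin> D"
proof -
  have "finite (snd ` D)" using D by simp
  then obtain B where B: "\<And>x. x \<in> D \<Longrightarrow> snd x < B"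
    by (metis finite_nat_set_iff_bounded image_eqI)
  \<comment> \<open>At least \<open>2 * B\<close> unit steps are made. Fewer than \<open>B\<close>
    of them are spent coming down ray \<open>k\<close>, which leaves more than \<open>B\<close>
    steps outwards on ray 1.\<close>
  have "(a ^^ (2 * B)) x \<notin> D" if x: "x \<in> D" "a x \<noteq> x" for x
  proof
    assume "(a ^^ (2 * B)) x \<in> D"
    moreover define M where "M = 2 * B * \<alpha>"
    ultimately have bound: "snd ((houghton_gen k ^^ M) x) < B"
      using B a(1) funpow_mult[of "2 * B" \<alpha> "houghton_gen k"] by (simp add: mult.commute)
    obtain i m where im: "x = (i, m)" by force
    have m: "m \<ge> 1" "i = 1 \<or> i = k"
      using x(2) houghton_gen_funpow_fix[of m i k \<alpha>] unfolding im a(1) by (cases m; auto)+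
    have "m < B" using B[OF x(1)] im by simp
    moreover have "M \<ge> 2 * B" using a(2) by (simp add: M_def)
    ultimately show False
      using bound m houghton_gen_funpow_1[OF m(1), of M k]
        houghton_gen_funpow_k[OF k m(1), of M]
      unfolding im by (auto split: if_splits)
  qed
  then show ?thesis by blast
qed

text \<open>On its way from ray 2 to ray 1 every orbit passes through one of the first
  \<open>\<alpha>\<close> points of ray 1. As \<open>y\<close> is a fixed point, its class is
  invariant under the power, so those \<open>\<alpha>\<close> points decide both rays.\<close>

lemma cyc3_rel_rays_12:
  assumes K: "subgroup K (Sym X)" and aK: "houghton_gen 2 ^^ \<alpha> \<in> K" and \<alpha>: "\<alpha> \<ge> 1"
    and y: "(houghton_gen 2 ^^ \<alpha>) y = y"
    and start: "\<And>j. j \<in> {1..\<alpha>} \<Longrightarrow> cyc3_rel K y (1, j)"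
    and i: "i \<in> {1, 2}" and m: "m \<ge> 1"
  shows "cyc3_rel K y (i, m)"
proof -
  define a where "a = houghton_gen 2 ^^ \<alpha>"
  have step: "cyc3_rel K y (a z) \<longleftrightarrow> cyc3_rel K y z" for z
    by (rule cyc3_rel_cong_map[OF K aK[folded a_def], of y y])
      (use y in \<open>simp_all add: a_def cyc3_rel_refl\<close>)
  have steps: "cyc3_rel K y ((a ^^ N) z) \<longleftrightarrow> cyc3_rel K y z" for N z
    by (induction N) (simp_all add: step)
  have ray1: "cyc3_rel K y (1, m)" if "m \<ge> 1" for m
    using that
  proof (induction m rule: less_induct)
    case (less m)
    show ?case
    proof (cases "m \<le> \<alpha>")
      case False
      then have "a (1, m - \<alpha>) = (1, m)"
        using houghton_gen_funpow_1[of "m - \<alpha>" \<alpha> 2] by (simp add: a_def)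
      then show ?thesis using step[of "(1, m - \<alpha>)"] less.IH[of "m - \<alpha>"] \<alpha> False by simp
    qed (use less start in auto)
  qed
  \<comment> \<open>The total displacement \<open>m * \<alpha>\<close> is at least \<open>m\<close>,
    just enough to leave ray 2.\<close>
  have "(a ^^ m) (2, m) = (1, m * \<alpha> - m + 1)"
    using m \<alpha> houghton_gen_funpow_k[of 2 m "m * \<alpha>"] funpow_mult[of m \<alpha> "houghton_gen 2"]
    by (auto simp: a_def mult.commute not_less)
  then have "cyc3_rel K y (2, m)"
    using steps[of m "(2, m)"] ray1[of "m * \<alpha> - m + 1"] by simp
  then show ?thesis using i ray1[OF m] by auto
qed

text \<open>The model case of the later argument: the inverse of \<open>houghton_gen 3\<close>
  pushes ray 3 outwards and fills \<open>(3, 1)\<close> from \<open>(1, 1)\<close>, so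
  \<open>(3, 1)\<close> is the only fixed point of \<open>houghton_gen 2\<close> missing from the
  image of its fixed points.\<close>

lemma Alt_subset_houghton:
  assumes "n \<ge> 3"
  shows "Alt (ray_space n) \<subseteq> carrier (houghton n)"
proof -
  define K where "K = carrier (houghton n)"
  have K: "subgroup K (ray_Sym n)" unfolding K_def by (rule subgroup_houghton)
  have gK: "houghton_gen k \<in> K" if "k \<in> {2..n}" for k
    unfolding K_def by (rule houghton_gen_in_houghton[OF that])
  define a where "a = houghton_gen 2"
  define b where "b = inv' (houghton_gen 3)"
  have aK: "a \<in> K" and bK: "b \<in> K"
    unfolding a_def b_def using assms gK subgroup_Sym_inv[OF K] by auto
  have bij3: "bij (houghton_gen 3)"
    using assms by (intro permutes_bij[OF houghton_gen_permutes]) auto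
  then have invb: "inv' b = houghton_gen 3" by (simp add: b_def inv_inv_eq)
  have b: "b z = w" if "houghton_gen 3 w = z" for z w
    unfolding b_def using bij3 that by (metis bij_inv_eq_iff)
  have fix_a: "a (i, m) = (i, m) \<longleftrightarrow> m = 0 \<or> i \<noteq> 1 \<and> i \<noteq> 2" for i m
    using houghton_gen_funpow_fixed_points[of 2 1 i m] by (simp add: a_def)
  have ends: "a \<in> ends n" "b \<in> ends n"
    using aK bK houghton_subset_ends unfolding K_def by auto
  have "cyc3_rel K (3, 1) (b (a (inv' b (3, 1))))"
  proof (rule cyc3_rel_commutator[OF K aK bK])
    show "finite {x. (b \<circ> a \<circ> inv' b \<circ> inv' a) x \<noteq> x}"
      using commutator_ends_in_FSym[OF ends(2,1)] by (simp add: commutator_def FSym_def)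
    have img: "x \<in> b ` {x. a x = x} \<longleftrightarrow> a (houghton_gen 3 x) = houghton_gen 3 x" for x
      using b bij3 by (auto simp: b_def image_iff bij_inv_eq_iff)
    have "x \<in> {x. a x = x} - b ` {x. a x = x} \<longleftrightarrow> x = (3, 1)" for x
      unfolding Diff_iff img mem_Collect_eq
      by (cases x) (auto simp: fix_a houghton_gen_def split: if_splits)
    then show "{x. a x = x} - b ` {x. a x = x} = {(3, 1)}" by blast
    show "\<exists>N. \<forall>x\<in>D. a x \<noteq> x \<longrightarrow> (a ^^ N) x \<notin> D" if "finite D" for D
      using houghton_gen_funpow_wanders[of 2 a 1 D] that by (simp add: a_def)
  qed
  moreover have "b (a (inv' b (3, 1))) = (1, 1)"
    unfolding invb by (rule b) (simp add: a_def houghton_gen_def)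
  ultimately have start: "cyc3_rel K (3, 1) (1, 1)" by simp
  have rays: "cyc3_rel K (3, 1) (i, m)" if "i \<in> {1, 2}" "m \<ge> 1" for i m
    by (rule cyc3_rel_rays_12[OF K, of 1]) (use aK start that in \<open>auto simp: a_def houghton_gen_def\<close>)
  have others: "cyc3_rel K (3, 1) (k, m)" if k: "k \<in> {3..n}" and "m \<ge> 1" for k m
  proof -
    \<comment> \<open>The test point is \<open>(1, 1)\<close>: its image \<open>(1, 2)\<close> is
      already known to be in the class.\<close>
    have "cyc3_rel K (3, 1) (houghton_gen k z) \<longleftrightarrow> cyc3_rel K (3, 1) z" for z
      by (rule cyc3_rel_cong_map[OF K gK, of _ _ "(1, 1)"])
        (use k rays[of 1 1] rays[of 1 2] in \<open>auto simp: houghton_gen_def numeral_2_eq_2\<close>)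
    then have "cyc3_rel K (3, 1) ((houghton_gen k ^^ N) z) \<longleftrightarrow> cyc3_rel K (3, 1) z" for N z
      by (induction N) simp_all
    moreover have "(houghton_gen k ^^ m) (k, m) = (1, 1)"
      using k that houghton_gen_funpow_k[of k m m] by simp
    ultimately show ?thesis using start by metis
  qed
  have "cyc3_rel K (3, 1) x" if "x \<in> ray_space n" for x
    using that rays others by (cases x; cases "fst x \<in> {1, 2}") (auto simp: ray_space_def)
  then show ?thesis
    using Alt_subset_if_cyc3_rel[OF K, of "(3, 1)"] by (simp add: K_def)
qed

lemma G2_subset_houghton:
  assumes "n \<ge> 3"
  shows "carrier (houghton_G2 n) \<subseteq> carrier (houghton n)"
  unfolding carrier_houghton_G2
proof (rule group.generate_subgroup_incl[OF group_Sym _ subgroup_houghton])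
  show "Alt (ray_space n) \<union> (\<lambda>k. houghton_gen k ^^ 2) ` {2..n} \<subseteq> carrier (houghton n)"
    using Alt_subset_houghton[OF assms] subgroup_Sym_funpow[OF subgroup_houghton houghton_gen_in_houghton]
    by blast
qed

section \<open>Index and rank\<close>

lemma (in group) finite_rcosets_if_classified:
  assumes N: "subgroup N G" and B: "finite B" "\<And>x. x \<in> carrier G \<Longrightarrow> \<phi> x \<in> B"
    and \<phi>: "\<And>x y. x \<in> carrier G \<Longrightarrow> y \<in> carrier G \<Longrightarrow> \<phi> x = \<phi> y \<Longrightarrow> x \<otimes> inv y \<in> N"
  shows "finite (rcosets N)"
proof -
  define r where "r = (\<lambda>b. SOME x. x \<in> carrier G \<and> \<phi> x = b)"
  have "N #> x = N #> r (\<phi> x)" if x: "x \<in> carrier G" for x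
  proof -
    have r: "r (\<phi> x) \<in> carrier G" "\<phi> (r (\<phi> x)) = \<phi> x"
      using someI[of "\<lambda>z. z \<in> carrier G \<and> \<phi> z = \<phi> x" x] x by (auto simp: r_def)
    have "x \<in> N #> r (\<phi> x)"
      using subgroup.rcos_module_rev[OF N is_group r(1) x] \<phi>[OF x r(1)] r(2) by simp
    then show ?thesis using repr_independence[OF _ r(1) N] by simp
  qed
  then have "rcosets N \<subseteq> (\<lambda>b. N #> r b) ` B"
    using B(2) by (auto simp: RCOSETS_def)
  then show ?thesis using B(1) finite_surj by blast
qed

text \<open>An element with even shifts is a finitary permutation times an element of
  \<open>G\<^sub>2\<close>, and only the parity of the finitary factor matters. Two elements outside
  \<open>G\<^sub>2\<close> have odd factors, which combine to an even one.\<close>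

lemma quotient_in_G2_if_even_shifts:
  assumes n: "n \<ge> 3" and uv: "u \<in> carrier (houghton n)" "v \<in> carrier (houghton n)"
    and even: "\<And>k. k \<in> {2..n} \<Longrightarrow> even (shift u k)" "\<And>k. k \<in> {2..n} \<Longrightarrow> even (shift v k)"
    and same: "u \<in> carrier (houghton_G2 n) \<longleftrightarrow> v \<in> carrier (houghton_G2 n)"
  shows "inv' v \<circ> u \<in> carrier (houghton_G2 n)"
proof -
  note G2 = subgroup_houghton_G2[of n] and H = subgroup_houghton[of n]
  have decomp: "\<exists>g\<in>carrier (houghton_G2 n). \<exists>s\<in>FSym (ray_space n). w = s \<circ> g"
    if w: "w \<in> carrier (houghton n)" and ev: "\<And>k. k \<in> {2..n} \<Longrightarrow> even (shift w k)" for w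
  proof -
    obtain g where g: "g \<in> carrier (houghton_G2 n)" "\<forall>k\<in>{2..n}. shift g k = 2 * (shift w k div 2)"
      using G2_realizes_even_shifts[of n "\<lambda>k. shift w k div 2"] by blast
    have gH: "g \<in> carrier (houghton n)" using g(1) G2_subset_houghton[OF n] by blast
    then have e: "w \<in> ends n" "g \<in> ends n" "inv' g \<in> ends n"
      using w houghton_subset_ends subgroup_Sym_inv[OF subgroup_ends] by blast+
    have "w \<circ> inv' g \<in> FSym (ray_space n)"
    proof (rule houghton_kernel)
      show "w \<circ> inv' g \<in> carrier (houghton n)"
        using w gH by (intro subgroup_Sym_comp[OF H] subgroup_Sym_inv[OF H])
      show "shift (w \<circ> inv' g) k = 0" if "k \<in> {2..n}" for k
        using that e g(2) ev[OF that] shift_comp[OF e(1,3), of k] shift_inv[OF e(2), of k] by simp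
    qed
    moreover have "w = (w \<circ> inv' g) \<circ> g"
      using ends_bij[OF e(2)] by (simp add: fun_eq_iff bij_is_inj)
    ultimately show ?thesis using g(1) by blast
  qed
  obtain g s where g: "g \<in> carrier (houghton_G2 n)" "s \<in> FSym (ray_space n)" "u = s \<circ> g"
    using decomp[OF uv(1) even(1)] by blast
  obtain h t where h: "h \<in> carrier (houghton_G2 n)" "t \<in> FSym (ray_space n)" "v = t \<circ> h"
    using decomp[OF uv(2) even(2)] by blast
  show ?thesis
  proof (cases "u \<in> carrier (houghton_G2 n)")
    case True
    then show ?thesis
      using same by (intro subgroup_Sym_comp[OF G2] subgroup_Sym_inv[OF G2]) auto
  next
    case False
    have "s \<notin> Alt (ray_space n)" "t \<notin> Alt (ray_space n)"
      using False same g h Alt_subset_G2 subgroup_Sym_comp[OF G2] by auto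
    then have odd: "\<not> evenperm s" "\<not> evenperm t" using g h by (auto simp: Alt_def)
    have perm: "permutation s" "permutation t" using g h permutation_of_FSym by auto
    have "evenperm (inv' t \<circ> s)"
      using odd perm by (simp add: evenperm_comp[OF permutation_inverse] evenperm_inv del: o_apply)
    then have st: "inv' t \<circ> s \<in> carrier (houghton_G2 n)"
      using Alt_subset_G2 FSym_comp[OF FSym_inv[OF h(2)] g(2)] by (auto simp: Alt_def)
    have bij: "bij t" "bij h"
      using perm(2) h(1) G2_subset_ends ends_bij permutation_bijective by blast+
    have "inv' v \<circ> u = inv' h \<circ> ((inv' t \<circ> s) \<circ> g)"
      using bij by (simp add: g h o_inv_distrib o_assoc)
    then show ?thesis
      using subgroup_Sym_comp[OF G2 subgroup_Sym_inv[OF G2 h(1)] subgroup_Sym_comp[OF G2 st g(1)]]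
      by (simp only:)
  qed
qed

lemma finite_index_houghton_G2:
  assumes n: "n \<ge> 3"
  shows "finite_index_subgroup (carrier (houghton_G2 n)) (houghton n)"
proof -
  interpret S: group "ray_Sym n" by (rule group_Sym)
  note H = subgroup_houghton[of n] and G2 = subgroup_houghton_G2[of n]
  interpret H: group "houghton n"
    unfolding houghton_def by (rule S.group_subgroup_generated)
  have sub: "subgroup (carrier (houghton_G2 n)) (houghton n)"
    using S.subgroup_incl[OF G2 H G2_subset_houghton[OF n]] houghton_eq[of n] by simp
  \<comment> \<open>Two invariants classify the cosets: the set of rays with odd shift and, relative
    to a chosen representative \<open>r\<close> of that set, one bit for membership in
    \<open>G\<^sub>2\<close>.\<close>
  define P where "P = (\<lambda>h. {k \<in> {2..n}. odd (shift h k)})"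
  define r where "r = (\<lambda>Q. SOME x. x \<in> carrier (houghton n) \<and> P x = Q)"
  define \<phi> where "\<phi> = (\<lambda>h. (P h, inv' (r (P h)) \<circ> h \<in> carrier (houghton_G2 n)))"
  have "finite (rcosets\<^bsub>houghton n\<^esub> (carrier (houghton_G2 n)))"
  proof (rule H.finite_rcosets_if_classified[OF sub])
    show "finite (Pow {2..n} \<times> (UNIV :: bool set))" by simp
    show "\<phi> x \<in> Pow {2..n} \<times> UNIV" for x by (auto simp: \<phi>_def P_def)
    fix x y assume x: "x \<in> carrier (houghton n)" and y: "y \<in> carrier (houghton n)" and eq: "\<phi> x = \<phi> y"
    define c where "c = r (P x)"
    have c: "c \<in> carrier (houghton n)" "P c = P x"
      using someI[of "\<lambda>z. z \<in> carrier (houghton n) \<and> P z = P x" x] x by (auto simp: c_def r_def)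
    have Pxy: "P y = P x" using eq by (simp add: \<phi>_def)
    have even: "even (shift (inv' c \<circ> w) k)"
      if "w \<in> carrier (houghton n)" "P w = P x" "k \<in> {2..n}" for w k
    proof -
      have e: "w \<in> ends n" "c \<in> ends n" "inv' c \<in> ends n"
        using that(1) c houghton_subset_ends subgroup_Sym_inv[OF subgroup_ends] by blast+
      have "shift (inv' c \<circ> w) k = shift w k - shift c k"
        using that(3) shift_comp[OF e(3,1), of k] shift_inv[OF e(2), of k] by simp
      moreover have "odd (shift w k) \<longleftrightarrow> odd (shift c k)"
        using that c(2) by (auto simp: P_def)
      ultimately show ?thesis by simp
    qed
    have "inv' (inv' c \<circ> y) \<circ> (inv' c \<circ> x) \<in> carrier (houghton_G2 n)"
      using x y c even[OF x] even[OF y] Pxy eq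
      by (intro quotient_in_G2_if_even_shifts[OF n] subgroup_Sym_comp[OF H] subgroup_Sym_inv[OF H])
        (auto simp: \<phi>_def c_def)
    moreover have "inv' (inv' c \<circ> y) \<circ> (inv' c \<circ> x) = inv' y \<circ> x"
    proof -
      have "bij c" "bij y"
        using c(1) y houghton_subset_ends ends_bij by blast+
      then show ?thesis
        by (simp add: o_inv_distrib bij_imp_bij_inv inv_inv_eq fun_eq_iff bij_is_surj surj_f_inv_f)
    qed
    moreover have "inv\<^bsub>houghton n\<^esub> y = inv' y"
      using y S.inv_subgroup_generated[of y] inv_Sym[OF subgroup_Sym_permutes[OF H y]]
      by (simp add: houghton_def)
    ultimately show "x \<otimes>\<^bsub>houghton n\<^esub> inv\<^bsub>houghton n\<^esub> y \<in> carrier (houghton_G2 n)"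
      by (simp add: houghton_def)
  qed
  with sub show ?thesis by (simp add: finite_index_subgroup_def)
qed

text \<open>For a subgroup of \<open>ends n\<close> this says that the lattice of shifts on rays 2
  to n has rank n - 1: such a lattice contains a nonzero multiple of each coordinate vector.\<close>

definition full_rank :: "nat \<Rightarrow> (nat \<times> nat \<Rightarrow> nat \<times> nat) set \<Rightarrow> bool"
  where "full_rank n K \<longleftrightarrow>
    (\<forall>k\<in>{2..n}. \<exists>w\<in>K. shift w k \<noteq> 0 \<and> (\<forall>j\<in>{2..n} - {k}. shift w j = 0))"

text \<open>Two distinct powers of \<open>houghton_gen k ^^ 2\<close> lie in one coset of
  \<open>U\<close>, and among rays 2 to n their quotient shifts only ray \<open>k\<close>.\<close>

lemma finite_index_full_rank:
  assumes U: "finite_index_subgroup U (houghton_G2 n)"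
  shows "full_rank n U"
  unfolding full_rank_def
proof
  fix k assume k: "k \<in> {2..n}"
  define f where "f = (\<lambda>i::nat. (houghton_gen k ^^ 2) ^^ i)"
  have f: "f i \<in> carrier (houghton_G2 n)" for i
    unfolding f_def by (rule subgroup_Sym_funpow[OF subgroup_houghton_G2 houghton_gen_sq_in_G2[OF k]])
  have U': "finite_index_subgroup U ((ray_Sym n)\<lparr>carrier := carrier (houghton_G2 n)\<rparr>)"
    using U houghton_G2_eq by simp
  obtain i j where ij: "i \<noteq> j" "inv' (f j) \<circ> f i \<in> U"
    using finite_index_pigeonhole_Sym[of _ _ _ UNIV f f, OF subgroup_houghton_G2 U' infinite_UNIV_nat f f]
    by blast
  have e: "f i \<in> ends n" "f j \<in> ends n" "inv' (f j) \<in> ends n"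
    using f G2_subset_ends subgroup_Sym_inv[OF subgroup_ends] by blast+
  have s: "shift (inv' (f j) \<circ> f i) l = (if l = k then 2 * (int j - int i) else 0)" if "l \<in> {2..n}" for l
  proof -
    have "shift (f N) l = (if k = l then - 2 * int N else 0)" for N
      using that shift_funpow[OF houghton_gen_sq_in_ends[OF k], of l N] shift_houghton_gen_funpow[OF k that, of 2]
      by (simp add: f_def)
    then show ?thesis
      using that shift_comp[OF e(3,1), of l] shift_inv[OF e(2), of l] by auto
  qed
  show "\<exists>w\<in>U. shift w k \<noteq> 0 \<and> (\<forall>j\<in>{2..n} - {k}. shift w j = 0)"
    by (rule bexI[OF _ ij(2)]) (use s k ij(1) in auto)
qed

lemma full_rank_houghton: "full_rank n (carrier (houghton n))"
  unfolding full_rank_def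
proof
  fix k assume k: "k \<in> {2..n}"
  show "\<exists>w\<in>carrier (houghton n). shift w k \<noteq> 0 \<and> (\<forall>j\<in>{2..n} - {k}. shift w j = 0)"
    by (rule bexI[OF _ houghton_gen_in_houghton[OF k]]) (use k in \<open>auto simp: shift_houghton_gen\<close>)
qed

lemma vector_space_fun: "vector_space (\<lambda>(c :: 'a :: field) (f :: 'b \<Rightarrow> 'a) x. c * f x)"
  by unfold_locales (simp_all add: fun_eq_iff algebra_simps)

text \<open>By additivity the shift vectors of all words lie in the rational span of those of
  \<open>S\<close>; full rank puts n - 1 independent coordinate vectors into this span.\<close>

lemma card_ge_if_full_rank:
  assumes S: "finite S" "S \<subseteq> ends n" and full: "full_rank n (generate (ray_Sym n) S)"
  shows "n - 1 \<le> card S"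
proof -
  interpret V: vector_space "\<lambda>(c :: rat) (f :: nat \<Rightarrow> rat) x. c * f x" by (rule vector_space_fun)
  define v where "v = (\<lambda>p k. if k \<in> {2..n} then rat_of_int (shift p k) else 0)"
  define e where "e = (\<lambda>k j :: nat. if j = k then 1 else 0 :: rat)"
  have v_span: "p \<in> ends n \<and> v p \<in> V.span (v ` S)" if "p \<in> generate (ray_Sym n) S" for p
    using that
  proof (induction p rule: generate.induct)
    case one
    have "v id = 0" by (simp add: v_def fun_eq_iff shift_id del: id_apply)
    then show ?case by (simp only: one_Sym subgroup_Sym_id[OF subgroup_ends] V.span_zero)
  next
    case (incl h)
    then show ?case using S(2) V.span_base by blast
  next
    case (inv h)
    then have h: "h \<in> ends n" using S(2) by blast
    have "v (inv' h) = (\<lambda>x. - 1 * v h x)"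
      by (auto simp: v_def fun_eq_iff shift_inv[OF h])
    moreover have "(\<lambda>x. - 1 * v h x) \<in> V.span (v ` S)"
      using inv by (intro V.span_scale V.span_base) auto
    ultimately show ?case
      using h subgroup_Sym_inv[OF subgroup_ends h] by (simp add: inv_Sym ends_def)
  next
    case (eng p q)
    then have pq: "p \<in> ends n" "q \<in> ends n" by auto
    have "v (q \<circ> p) = v q + v p"
      by (auto simp: v_def fun_eq_iff shift_comp[OF pq(2,1)])
    moreover have "v q + v p \<in> V.span (v ` S)"
      using eng.IH by (intro V.span_add) auto
    ultimately show ?case
      using subgroup_Sym_comp[OF subgroup_ends pq(2,1)] by (simp only: mult_Sym)
  qed
  have e_span: "e k \<in> V.span (v ` S)" if k: "k \<in> {2..n}" for k
  proof -
    obtain w where w: "w \<in> generate (ray_Sym n) S" "shift w k \<noteq> 0" "\<forall>j\<in>{2..n} - {k}. shift w j = 0"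
      using full k unfolding full_rank_def by blast
    have "e k = (\<lambda>x. (1 / rat_of_int (shift w k)) * v w x)"
      using w k by (auto simp: e_def v_def fun_eq_iff)
    then show ?thesis using v_span[OF w(1)] V.span_scale by metis
  qed
  have "V.independent (e ` {2..m})" for m
  proof (induction m)
    case (Suc m)
    show ?case
    proof (cases "m = 0")
      case False
      have "V.subspace {f. f (Suc m) = 0}"
        by (rule V.subspaceI) auto
      then have "V.span (e ` {2..m}) \<subseteq> {f. f (Suc m) = 0}"
        by (intro V.span_minimal) (auto simp: e_def)
      then have "e (Suc m) \<notin> V.span (e ` {2..m})" by (auto simp: e_def)
      moreover have "e ` {2..Suc m} = insert (e (Suc m)) (e ` {2..m})"
        using False by (auto simp: atLeastAtMostSuc_conv)
      ultimately show ?thesis using V.independent_insertI Suc by simp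
    qed (simp add: V.independent_empty)
  qed (simp add: V.independent_empty)
  then have "card (e ` {2..n}) \<le> card (v ` S)"
    using V.independent_span_bound[of "v ` S" "e ` {2..n}"] S(1) e_span by blast
  moreover have "inj_on e {2..n}"
    by (rule inj_onI) (metis e_def zero_neq_one)
  ultimately show ?thesis
    using card_image_le[OF S(1), of v] by (simp add: card_image)
qed

lemma min_gens_eqI:
  assumes K: "subgroup K (Sym X)"
    and ex: "finite S" "generate (Sym X) S = K" "card S \<le> m"
    and least: "\<And>T. finite T \<Longrightarrow> generate (Sym X) T = K \<Longrightarrow> m \<le> card T"
  shows "min_gens ((Sym X)\<lparr>carrier := K\<rparr>) = enat m"
proof (rule antisym)
  have cons: "generate ((Sym X)\<lparr>carrier := K\<rparr>) T = generate (Sym X) T" if "T \<subseteq> K" for T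
    using group.generate_consistent[OF group_Sym that K] .
  have "S \<subseteq> K" using ex(2) by (auto intro: generate.incl)
  then have "min_gens ((Sym X)\<lparr>carrier := K\<rparr>) \<le> enat (card S)"
    unfolding min_gens_def using ex cons by (intro INF_lower) auto
  also have "\<dots> \<le> enat m" using ex(3) by simp
  finally show "min_gens ((Sym X)\<lparr>carrier := K\<rparr>) \<le> enat m" .
  show "enat m \<le> min_gens ((Sym X)\<lparr>carrier := K\<rparr>)"
    unfolding min_gens_def using cons least by (intro INF_greatest) auto
qed

section \<open>Triangular bases and their adjustment\<close>

text \<open>A row of the Hermite normal form of the lattice of shifts of \<open>U\<close>.\<close>

lemma exists_hermite_row:
  assumes U: "subgroup U (ray_Sym n)" "U \<subseteq> ends n" and full: "full_rank n U" and k: "k \<in> {2..n}"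
  shows "\<exists>u\<in>U. shift u k < 0 \<and> (\<forall>j\<in>{2..n}. k < j \<longrightarrow> shift u j = 0) \<and>
    (\<forall>w\<in>U. (\<forall>j\<in>{2..n}. k < j \<longrightarrow> shift w j = 0) \<longrightarrow> shift u k dvd shift w k)"
proof -
  define Z where "Z = {w \<in> U. \<forall>j\<in>{2..n}. k < j \<longrightarrow> shift w j = 0}"
  have k1: "k \<in> {1..n}" using k by simp
  have e: "w \<in> ends n" if "w \<in> U" for w using that U(2) by blast
  have Z_comp: "p \<circ> q \<in> Z" if "p \<in> Z" "q \<in> Z" for p q
    using that e subgroup_Sym_comp[OF U(1), of p q] shift_comp[of p n q] by (auto simp: Z_def)
  have Z_inv: "inv' p \<in> Z" if "p \<in> Z" for p
    using that e subgroup_Sym_inv[OF U(1), of p] shift_inv[of p n] by (auto simp: Z_def)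
  have Z_pow: "p [^]\<^bsub>ray_Sym n\<^esub> (q::int) \<in> Z" if "p \<in> Z" for p q
    using that e group.subgroup_int_pow_closed[OF group_Sym U(1), of p q] shift_int_pow[of p n _ q]
    by (auto simp: Z_def)
  \<comment> \<open>The sign is chosen so that the row moves ray \<open>k\<close> inwards, as
    \<open>houghton_gen k\<close> does. Minimality of \<open>c\<close> gives divisibility by the
    remainder argument.\<close>
  define Q where "Q = (\<lambda>c::nat. c > 0 \<and> (\<exists>w\<in>Z. shift w k = - int c))"
  obtain w where w: "w \<in> Z" "shift w k \<noteq> 0"
    using full k by (force simp: full_rank_def Z_def)
  have neg: "Q (nat \<bar>shift w k\<bar>)" if "w \<in> Z" "shift w k \<noteq> 0" for w
  proof -
    have "\<exists>v\<in>Z. shift v k = - \<bar>shift w k\<bar>"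
    proof (cases "shift w k < 0")
      case False
      then show ?thesis
        using Z_inv[OF that(1)] shift_inv[OF e k1, of w] that by (intro bexI[of _ "inv' w"]) (auto simp: Z_def)
    qed (use that in auto)
    then show ?thesis using that by (auto simp: Q_def)
  qed
  define c where "c = (LEAST c. Q c)"
  have "Q c" unfolding c_def using neg[OF w] by (rule LeastI)
  then obtain u where u: "u \<in> Z" "shift u k = - int c" "c > 0" by (auto simp: Q_def)
  have "shift u k dvd shift v k" if v: "v \<in> Z" for v
  proof (rule ccontr)
    assume nd: "\<not> ?thesis"
    define q where "q = shift v k div int c"
    define z where "z = v \<circ> u [^]\<^bsub>ray_Sym n\<^esub> q"
    have z: "z \<in> Z" unfolding z_def using v u Z_comp Z_pow by blast
    have "v \<in> U" "u \<in> U" "u [^]\<^bsub>ray_Sym n\<^esub> q \<in> U"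
      using v u Z_pow[OF u(1), of q] by (auto simp: Z_def)
    then have "shift z k = shift v k - q * int c"
      unfolding z_def using shift_comp[OF e e k1] shift_int_pow[OF e k1] u(2) by simp
    also have "\<dots> = shift v k mod int c"
      by (simp add: q_def minus_div_mult_eq_mod)
    finally have sz: "shift z k = shift v k mod int c" .
    have "shift v k mod int c \<noteq> 0" using nd u by (simp add: dvd_eq_mod_eq_0[symmetric])
    then have "Q (nat \<bar>shift z k\<bar>)" using neg[OF z] sz by simp
    moreover have "nat \<bar>shift z k\<bar> < c" using sz u(3) by (simp add: nat_less_iff)
    ultimately show False using not_less_Least[of _ Q] unfolding c_def by blast
  qed
  then show ?thesis using u by (intro bexI[of _ u]) (auto simp: Z_def)
qed

text \<open>Elimination from the highest ray down: \<open>v k\<close> vanishes above ray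
  \<open>k\<close> and so leaves cleared shifts untouched. What remains has zero shifts and lies in
  \<open>Alt\<close> by \<open>G2_kernel\<close>.\<close>

lemma subset_if_hermite_basis:
  assumes U: "subgroup U (ray_Sym n)" "U \<subseteq> carrier (houghton_G2 n)"
    and K: "subgroup K (ray_Sym n)" "Alt (ray_space n) \<subseteq> K"
    and v: "\<And>k. k \<in> {2..n} \<Longrightarrow> v k \<in> K" "\<And>k. k \<in> {2..n} \<Longrightarrow> v k \<in> U"
      "\<And>j k. k \<in> {2..n} \<Longrightarrow> j \<in> {2..n} \<Longrightarrow> k < j \<Longrightarrow> shift (v k) j = 0"
    and dvd: "\<And>k w. k \<in> {2..n} \<Longrightarrow> w \<in> U \<Longrightarrow> (\<forall>j\<in>{2..n}. k < j \<longrightarrow> shift w j = 0)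
      \<Longrightarrow> shift (v k) k dvd shift w k"
  shows "U \<subseteq> K"
proof -
  have e: "w \<in> ends n" if "w \<in> U" for w using that U(2) G2_subset_ends by blast
  have "w \<in> K" if "w \<in> U" "\<forall>j\<in>{2..n}. m < j \<longrightarrow> shift w j = 0" for m w
    using that
  proof (induction m arbitrary: w)
    case 0
    then have "w \<in> Alt (ray_space n)" using U(2) by (intro G2_kernel) auto
    then show ?case using K(2) by blast
  next
    case (Suc m)
    show ?case
    proof (cases "Suc m \<in> {2..n}")
      case False
      then have "\<forall>j\<in>{2..n}. m < j \<longrightarrow> shift w j = 0"
        using Suc.prems(2) by (metis Suc_lessI)
      then show ?thesis using Suc.IH Suc.prems(1) by blast
    next
      case True
      obtain q where q: "shift w (Suc m) = shift (v (Suc m)) (Suc m) * q"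
        using dvd[OF True Suc.prems] by (auto elim: dvdE)
      let ?x = "v (Suc m) [^]\<^bsub>ray_Sym n\<^esub> q"
      have x: "?x \<in> U" "?x \<in> K"
        using group.subgroup_int_pow_closed[OF group_Sym] U(1) K(1) v(1,2)[OF True] by blast+
      have ix: "inv' ?x \<in> U" using subgroup_Sym_inv[OF U(1) x(1)] .
      have sx: "shift (w \<circ> inv' ?x) j = shift w j - q * shift (v (Suc m)) j" if "j \<in> {2..n}" for j
      proof -
        have j: "j \<in> {1..n}" using that by auto
        show ?thesis
          using shift_comp[OF e[OF Suc.prems(1)] e[OF ix] j] shift_inv[OF e[OF x(1)] j]
            shift_int_pow[OF e[OF v(2)[OF True]] j, of q]
          by simp
      qed
      have "w \<circ> inv' ?x \<in> K"
      proof (rule Suc.IH)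
        show "w \<circ> inv' ?x \<in> U" using subgroup_Sym_comp[OF U(1) Suc.prems(1) ix] .
        show "\<forall>j\<in>{2..n}. m < j \<longrightarrow> shift (w \<circ> inv' ?x) j = 0"
        proof (intro ballI impI)
          fix j assume j: "j \<in> {2..n}" "m < j"
          show "shift (w \<circ> inv' ?x) j = 0"
          proof (cases "j = Suc m")
            case True
            then show ?thesis using sx[OF j(1)] q by simp
          next
            case False
            then show ?thesis using sx[OF j(1)] j Suc.prems(2) v(3)[OF True j(1)] by auto
          qed
        qed
      qed
      then have "(w \<circ> inv' ?x) \<circ> ?x \<in> K" using subgroup_Sym_comp[OF K(1) _ x(2)] by blast
      moreover have "(w \<circ> inv' ?x) \<circ> ?x = w"
        using ends_bij[OF e[OF x(1)]] by (simp add: fun_eq_iff bij_is_inj)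
      ultimately show ?thesis by simp
    qed
  qed
  from this[of _ n] show ?thesis by auto
qed

text \<open>To keep the values of \<open>u\<close> on \<open>P\<close>, the correction
  \<open>s\<close> is supported off the image of \<open>P\<close>; the new values must avoid that
  image, and its infinite complement leaves room for \<open>s\<close> to be even.\<close>

lemma exists_Alt_adjustment:
  assumes u: "u permutes X" and E: "finite E" "E \<subseteq> X" "E \<inter> P = {}"
    and h: "inj_on h E" "h ` E \<subseteq> X" "h ` E \<inter> u ` P = {}" and inf: "infinite (X - u ` P)"
  shows "\<exists>s\<in>Alt X. (\<forall>x\<in>E. (s \<circ> u) x = h x) \<and> (\<forall>x\<in>P. (s \<circ> u) x = u x)"
proof -
  have "u ` E \<inter> u ` P = {}"
    using E(3) permutes_inj[OF u] by (simp flip: image_Int)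
  moreover have "u ` E \<subseteq> X" using E(2) permutes_image[OF u] by blast
  ultimately have "u ` E \<subseteq> X - u ` P" by blast
  then obtain s where s: "s \<in> Alt (X - u ` P)" "\<forall>x\<in>E. s (u x) = h x"
    using Alt_extend_inj[OF inf E(1), of u h] h permutes_inj_on[OF u] by blast
  have "s (u x) = u x" if "x \<in> P" for x
    using s(1) that permutes_not_in by (fastforce simp: Alt_def FSym_def)
  then show ?thesis
    using s Alt_mono[of "X - u ` P" X] by (intro bexI[of _ s]) auto
qed

lemma translates_eventually_ge:
  assumes "u \<in> ends n" "i \<in> {1..n}"
  shows "\<exists>M\<ge>B. \<forall>m>M. u (i, m) = (i, nat (int m + shift u i))"
  using translates_shift[OF assms] unfolding translates_def eventually_sequentially
  by (metis dual_order.strict_implies_order le_trans max.cobounded1 max.cobounded2)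

lemma infinite_ray: "n \<ge> 1 \<Longrightarrow> Q \<inter> {1} \<times> UNIV = {} \<Longrightarrow> infinite (ray_space n - Q)"
proof
  assume n: "n \<ge> 1" and Q: "Q \<inter> {1} \<times> UNIV = {}" and fin: "finite (ray_space n - Q)"
  have "Pair 1 ` {1..} \<subseteq> ray_space n - Q" using n Q by (auto simp: ray_space_def)
  then have "finite (Pair (1::nat) ` {1::nat..})" using fin finite_subset by blast
  then have "finite {1::nat..}" by (rule finite_imageD) (auto simp: inj_on_def)
  then show False by (simp add: infinite_Ici)
qed

text \<open>Fixing \<open>(3, 1)\<close> makes its class invariant under the lift, and each point of
  ray \<open>k\<close> goes to ray 1 or further down ray \<open>k\<close>, so induction will bring
  the whole ray into the class. Beyond \<open>M\<close> the eventual translation has set in.\<close>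

lemma exists_adjusted_outer_generator:
  assumes u: "u \<in> ends n" and k: "k \<in> {4..n}" and c: "shift u k = - int c" "c \<ge> 1"
  shows "\<exists>s\<in>Alt (ray_space n). (s \<circ> u) (3, 1) = (3, 1) \<and>
    (\<exists>M\<ge>c. (\<forall>m>M. (s \<circ> u) (k, m) = (k, m - c)) \<and> (\<forall>m\<in>{1..M}. (s \<circ> u) (k, m) = (1, m)))"
proof -
  obtain M where "M \<ge> c" and M: "\<And>m. m > M \<Longrightarrow> u (k, m) = (k, m - c)"
    using translates_eventually_ge[OF u, of k c] k c by (auto simp: nat_diff_distrib')
  define P where "P = {k} \<times> {M<..}"
  define E where "E = insert (3, 1) ({k} \<times> {1..M})"
  define h :: "nat \<times> nat \<Rightarrow> nat \<times> nat" where "h = (\<lambda>(i, m). if i = 3 then (3, 1) else (1, m))"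
  have uP: "u ` P \<subseteq> {k} \<times> UNIV" by (auto simp: P_def M)
  have "\<exists>s\<in>Alt (ray_space n). (\<forall>x\<in>E. (s \<circ> u) x = h x) \<and> (\<forall>x\<in>P. (s \<circ> u) x = u x)"
  proof (rule exists_Alt_adjustment)
    show "u permutes ray_space n" using u by (simp add: ends_def)
    show "infinite (ray_space n - u ` P)" using uP k by (intro infinite_ray) auto
    show "inj_on h E" using k by (auto simp: inj_on_def h_def E_def)
    show "h ` E \<inter> u ` P = {}" using uP k by (auto simp: h_def E_def)
  qed (use k in \<open>auto simp: E_def P_def h_def ray_space_def\<close>)
  then obtain s where s: "s \<in> Alt (ray_space n)" "\<And>x. x \<in> E \<Longrightarrow> (s \<circ> u) x = h x"
    "\<And>x. x \<in> P \<Longrightarrow> (s \<circ> u) x = u x" by blast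
  show ?thesis
  proof (intro bexI[OF _ s(1)] conjI exI[of _ M] allI impI ballI)
    show "M \<ge> c" by fact
    show "(s \<circ> u) (3, 1) = (3, 1)" by (subst s(2)) (auto simp: E_def h_def)
    show "(s \<circ> u) (k, m) = (k, m - c)" if "m > M" for m
      using that by (subst s(3)) (auto simp: P_def M)
    show "(s \<circ> u) (k, m) = (1, m)" if "m \<in> {1..M}" for m
      using that k by (subst s(2)) (auto simp: E_def h_def)
  qed
qed

text \<open>With \<open>a\<close> the \<open>\<alpha>\<close>-th power of the second generator, the values below make \<open>(3, 1)\<close> the only fixed
  point of \<open>a\<close> outside the image under \<open>b = s \<circ> u\<close> of the fixed points of \<open>a\<close>, make the commutator of
  \<open>a\<close> and \<open>b\<close> send \<open>(3, 1)\<close> to \<open>(1, 2\<alpha>)\<close>, and let \<open>b\<close> map the \<open>a\<close>-orbit of that point to a set that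
  meets every infinite \<open>a\<close>-orbit.\<close>

lemma exists_adjusted_third_generator:
  assumes n: "n \<ge> 3" and u: "u \<in> ends n" and c: "shift u 3 = - int c" "c \<ge> 1"
    and zero: "\<And>j. j \<in> {4..n} \<Longrightarrow> shift u j = 0" and \<alpha>: "\<alpha> \<ge> 1"
  shows "\<exists>s\<in>Alt (ray_space n).
    (s \<circ> u) (3, 1) = (1, 3 * \<alpha>) \<and>
    (\<forall>m\<in>{2..c + 1}. (s \<circ> u) (3, m) = (1, 3 * \<alpha> + m)) \<and>
    (\<forall>m>c + 1. (s \<circ> u) (3, m) = (3, m - c)) \<and>
    (\<forall>j\<in>{4..n}. \<forall>m\<ge>1. (s \<circ> u) (j, m) = (j, m)) \<and>
    (\<forall>i\<in>{1..\<alpha>}. (s \<circ> u) (1, \<alpha> * i) = (1, i)) \<and>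
    (s \<circ> u) (1, \<alpha> * (\<alpha> + 1)) = (3, 1) \<and>
    (s \<circ> u) (1, \<alpha> * (\<alpha> + 2)) = (1, 2 * \<alpha>)"
proof -
  have "\<exists>N. \<forall>m>N. u (j, m) = (j, if j = 3 then m - c else m)" if "j \<in> {3..n}" for j
    using translates_eventually_ge[OF u, of j c] c zero[of j] that
    by (cases "j = 3") (auto simp: nat_diff_distrib')
  then obtain N where N: "\<And>j m. j \<in> {3..n} \<Longrightarrow> m > N j \<Longrightarrow> u (j, m) = (j, if j = 3 then m - c else m)"
    by metis
  \<comment> \<open>Including \<open>c + 1\<close> keeps the translated tail of ray 3 clear of
    \<open>(3, 1)\<close>, which is to be reached from ray 1.\<close>
  define M where "M = Max (insert (c + 1) (N ` {3..n}))"
  have Mc: "M \<ge> c + 1" unfolding M_def by simp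
  have "N j \<le> M" if "j \<in> {3..n}" for j unfolding M_def using that by (intro Max_ge) auto
  then have M: "u (j, m) = (j, if j = 3 then m - c else m)" if "j \<in> {3..n}" "m > M" for j m
    using N[of j m] that by fastforce
  define P where "P = {3..n} \<times> {M<..}"
  define E1 where "E1 = {3..n} \<times> {1..M}"
  define E2 where "E2 = (\<lambda>i. (1::nat, \<alpha> * i)) ` {1..\<alpha> + 2}"
  \<comment> \<open>Cutting at \<open>c + 1\<close> instead of \<open>c\<close> makes the translated
    part of ray 3 begin at \<open>(3, 2)\<close>. The displaced points go to ray 1 from
    \<open>3 * \<alpha>\<close> on, beyond all values of \<open>h2\<close> there.\<close>
  define h1 :: "nat \<times> nat \<Rightarrow> nat \<times> nat" where "h1 = (\<lambda>(j, m).
    if j \<noteq> 3 then (j, m)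
    else if m = 1 then (1, 3 * \<alpha>)
    else if m \<le> c + 1 then (1, 3 * \<alpha> + m)
    else (3, m - c))"
  \<comment> \<open>The first \<open>\<alpha>\<close> arguments yield one point of each residue
    class modulo \<open>\<alpha>\<close>. The last two belong to neighbours under \<open>a\<close>,
    so the conjugate of \<open>a\<close> takes \<open>(3, 1)\<close> to
    \<open>(1, 2 * \<alpha>)\<close>.\<close>
  define h2 :: "nat \<Rightarrow> nat \<times> nat" where "h2 = (\<lambda>i.
    if i \<le> \<alpha> then (1, i) else if i = \<alpha> + 1 then (3, 1) else (1, 2 * \<alpha>))"
  define h where "h = (\<lambda>x. if fst x = 1 then h2 (snd x div \<alpha>) else h1 x)"
  have h_E1: "h x = h1 x" if "x \<in> E1" for x using that by (auto simp: h_def E1_def)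
  have h_E2: "h (1, \<alpha> * i) = h2 i" "h (Suc 0, \<alpha> * i) = h2 i" for i
    using \<alpha> by (simp_all add: h_def)
  have img: "h ` E1 = h1 ` E1" "h ` E2 = h2 ` {1..\<alpha> + 2}"
    using h_E1 by (simp_all add: E2_def image_image h_E2)
  have uP: "u ` P \<subseteq> {3} \<times> {M - c<..} \<union> {4..n} \<times> {M<..}"
    using Mc by (auto simp: P_def M split: if_splits)
  have "\<exists>s\<in>Alt (ray_space n). (\<forall>x\<in>E1 \<union> E2. (s \<circ> u) x = h x) \<and> (\<forall>x\<in>P. (s \<circ> u) x = u x)"
  proof (rule exists_Alt_adjustment)
    show "u permutes ray_space n" using u by (simp add: ends_def)
    show "infinite (ray_space n - u ` P)" using uP n by (intro infinite_ray) auto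
    have "inj_on h E1"
      by (auto simp: inj_on_def h_E1) (auto simp: E1_def h1_def split: if_splits)
    moreover have "inj_on h2 {1..\<alpha> + 2}"
      using \<alpha> by (auto simp: inj_on_def h2_def split: if_splits)
    then have "inj_on h E2"
      unfolding E2_def by (intro inj_on_imageI) (simp add: o_def h_E2)
    moreover have "h1 x \<noteq> h2 i" if "x \<in> E1" "i \<in> {1..\<alpha> + 2}" for x i
      using that \<alpha> by (auto simp: E1_def h1_def h2_def split: if_splits)
    then have "h ` E1 \<inter> h ` E2 = {}"
      unfolding img by blast
    ultimately show "inj_on h (E1 \<union> E2)"
      unfolding inj_on_Un by blast
    have "h1 ` E1 \<inter> u ` P = {}" "h1 ` E1 \<subseteq> ray_space n"
      using uP n \<alpha> by (auto simp: E1_def h1_def ray_space_def split: if_splits)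
    moreover have "h2 ` {1..\<alpha> + 2} \<inter> u ` P = {}" "h2 ` {1..\<alpha> + 2} \<subseteq> ray_space n"
      using uP n \<alpha> Mc by (auto simp: h2_def ray_space_def split: if_splits)
    moreover have "h ` (E1 \<union> E2) = h1 ` E1 \<union> h2 ` {1..\<alpha> + 2}"
      by (simp only: image_Un img)
    ultimately show "h ` (E1 \<union> E2) \<inter> u ` P = {}" "h ` (E1 \<union> E2) \<subseteq> ray_space n"
      by auto
  qed (use \<alpha> n in \<open>auto simp: E1_def E2_def P_def ray_space_def\<close>)
  then obtain s where s: "s \<in> Alt (ray_space n)" "\<And>x. x \<in> E1 \<union> E2 \<Longrightarrow> (s \<circ> u) x = h x"
    "\<And>x. x \<in> P \<Longrightarrow> (s \<circ> u) x = u x"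
    by blast
  have ray1: "(s \<circ> u) (1, \<alpha> * i) = h2 i" if "i \<in> {1..\<alpha> + 2}" for i
  proof -
    have "(1, \<alpha> * i) \<in> E2" unfolding E2_def using that by (rule imageI)
    then show ?thesis using s(2)[OF UnI2] h_E2(1)[of i] by metis
  qed
  have inner: "(s \<circ> u) (j, m) = h1 (j, m)" if "j \<in> {3..n}" "m \<in> {1..M}" for j m
    using that s(2)[of "(j, m)"] h_E1[of "(j, m)"] by (simp add: E1_def)
  have outer: "(s \<circ> u) (j, m) = (j, if j = 3 then m - c else m)" if "j \<in> {3..n}" "m > M" for j m
    using that s(3)[of "(j, m)"] by (simp add: P_def M)
  show ?thesis
  proof (intro bexI[OF _ s(1)] conjI allI impI ballI)
    show "(s \<circ> u) (3, 1) = (1, 3 * \<alpha>)"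
      using n Mc by (subst inner) (auto simp: h1_def)
    show "(s \<circ> u) (3, m) = (1, 3 * \<alpha> + m)" if "m \<in> {2..c + 1}" for m
      using n Mc that by (subst inner) (auto simp: h1_def)
    show "(s \<circ> u) (3, m) = (3, m - c)" if "m > c + 1" for m
      using n that by (cases "m \<le> M"; subst inner outer) (auto simp: h1_def)
    show "(s \<circ> u) (j, m) = (j, m)" if "j \<in> {4..n}" "m \<ge> 1" for j m
    proof (cases "m \<le> M")
      case True
      then show ?thesis using that by (subst inner) (auto simp: h1_def)
    next
      case False
      then show ?thesis using that by (subst outer) auto
    qed
    show "(s \<circ> u) (1, \<alpha> * i) = (1, i)" if "i \<in> {1..\<alpha>}" for i
      using that by (subst ray1) (auto simp: h2_def)
    show "(s \<circ> u) (1, \<alpha> * (\<alpha> + 1)) = (3, 1)"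
      by (subst ray1) (auto simp: h2_def)
    show "(s \<circ> u) (1, \<alpha> * (\<alpha> + 2)) = (1, 2 * \<alpha>)"
      by (subst ray1) (auto simp: h2_def)
  qed
qed

section \<open>Generation by \<open>n - 1\<close> elements\<close>

text \<open>The commutator relates \<open>(3, 1)\<close> to a point of ray 1; after that
  \<open>a\<close>, \<open>b\<close> and the outer lifts all preserve the class of
  \<open>(3, 1)\<close>, and their prescribed values pull every ray into it.\<close>

lemma Alt_subset_if_adjusted_generators:
  assumes n: "n \<ge> 3" and K: "subgroup K (ray_Sym n)" "K \<subseteq> ends n" and \<alpha>: "\<alpha> \<ge> 1"
    and aK: "houghton_gen 2 ^^ \<alpha> \<in> K" and bK: "b \<in> K"
    and b: "b (3, 1) = (1, 3 * \<alpha>)" "\<And>m. m \<in> {2..c + 1} \<Longrightarrow> b (3, m) = (1, 3 * \<alpha> + m)"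
      "\<And>m. m > c + 1 \<Longrightarrow> b (3, m) = (3, m - c)" "c \<ge> 1"
      "\<And>j m. j \<in> {4..n} \<Longrightarrow> m \<ge> 1 \<Longrightarrow> b (j, m) = (j, m)"
      "\<And>i. i \<in> {1..\<alpha>} \<Longrightarrow> b (1, \<alpha> * i) = (1, i)"
      "b (1, \<alpha> * (\<alpha> + 1)) = (3, 1)" "b (1, \<alpha> * (\<alpha> + 2)) = (1, 2 * \<alpha>)"
    and outer: "\<And>k. k \<in> {4..n} \<Longrightarrow> \<exists>v\<in>K. \<exists>c\<ge>1. v (3, 1) = (3, 1) \<and>
      (\<exists>M\<ge>c. (\<forall>m>M. v (k, m) = (k, m - c)) \<and> (\<forall>m\<in>{1..M}. v (k, m) = (1, m)))"
  shows "Alt (ray_space n) \<subseteq> K"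
proof -
  define a where "a = houghton_gen 2 ^^ \<alpha>"
  let ?R = "cyc3_rel K (3, 1)"
  have aK': "a \<in> K" using aK by (simp add: a_def)
  have ends: "a \<in> ends n" "b \<in> ends n" using aK' bK K(2) by auto
  have bp: "b permutes ray_space n" using ends(2) by (simp add: ends_def)
  have fix_a: "a (i, m) = (i, m) \<longleftrightarrow> m = 0 \<or> i \<noteq> 1 \<and> i \<noteq> 2" for i m
    using houghton_gen_funpow_fixed_points[of 2 \<alpha> i m] \<alpha> by (simp add: a_def)
  have a1: "a (1, m) = (1, m + \<alpha>)" if "m \<ge> 1" for m
    using houghton_gen_funpow_1[OF that, of \<alpha> 2] by (simp add: a_def)
  have invb: "inv' b (3, 1) = (1, \<alpha> * (\<alpha> + 1))"
    using b(7) permutes_inverses(2)[OF bp] by metis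
  have "?R (b (a (inv' b (3, 1))))"
  proof (rule cyc3_rel_commutator[OF K(1) aK' bK])
    show "finite {x. (b \<circ> a \<circ> inv' b \<circ> inv' a) x \<noteq> x}"
      using commutator_ends_in_FSym[OF ends(2,1)] by (simp add: commutator_def FSym_def)
    show "\<exists>N. \<forall>x\<in>D. a x \<noteq> x \<longrightarrow> (a ^^ N) x \<notin> D" if "finite D" for D
      using houghton_gen_funpow_wanders[of 2 a \<alpha> D] that \<alpha> by (simp add: a_def)
    have not_image: "(3, 1) \<notin> b ` {x. a x = x}"
    proof
      assume "(3, 1) \<in> b ` {x. a x = x}"
      then obtain x where "b x = (3, 1)" "a x = x" by auto
      then have "a (1, \<alpha> * (\<alpha> + 1)) = (1, \<alpha> * (\<alpha> + 1))"
        using b(7) permutes_inj[OF bp] by (metis inj_eq)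
      then show False using fix_a[of 1 "\<alpha> * (\<alpha> + 1)"] \<alpha> by auto
    qed
    have image: "x \<in> b ` {x. a x = x}" if x: "a x = x" "x \<noteq> (3, 1)" for x
    proof -
      have img: "x \<in> b ` {x. a x = x}" if "b z = x" "a z = z" for z
        using image_eqI[of x b z "{x. a x = x}"] that by simp
      obtain i m where im: "x = (i, m)" by force
      show ?thesis
      proof (cases "x \<in> ray_space n")
        case False
        then have "b x = x" using permutes_not_in[OF bp] by blast
        then show ?thesis using x by (intro img)
      next
        case True
        then have im': "i \<in> {3..n}" "m \<ge> 1"
          using x(1) fix_a[of i m] by (auto simp: im ray_space_def)
        show ?thesis
        proof (cases "i = 3")
          case True
          then have "b (3, m + c) = x" using im im' x(2) b(3)[of "m + c"] by auto
          moreover have "a (3, m + c) = (3, m + c)" by (simp add: fix_a)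
          ultimately show ?thesis by (intro img)
        next
          case False
          then have "b x = x" using im im' b(5)[of i m] by auto
          then show ?thesis using x by (intro img)
        qed
      qed
    qed
    have "a (3, 1) = (3, 1)" by (simp add: fix_a)
    show "{x. a x = x} - b ` {x. a x = x} = {(3, 1)}"
    proof (rule Set.set_eqI)
      fix x
      show "x \<in> {x. a x = x} - b ` {x. a x = x} \<longleftrightarrow> x \<in> {(3, 1)}"
      proof (cases "x = (3, 1)")
        case True
        then show ?thesis using not_image \<open>a (3, 1) = (3, 1)\<close> by simp
      next
        case False
        then show ?thesis using image[OF _ False] by auto
      qed
    qed
  qed
  moreover have "b (a (inv' b (3, 1))) = (1, 2 * \<alpha>)"
    using a1[of "\<alpha> * (\<alpha> + 1)"] \<alpha> b(8) invb by (simp add: algebra_simps)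
  ultimately have p: "?R (1, 2 * \<alpha>)" by simp
  have a_step: "?R (a z) \<longleftrightarrow> ?R z" for z
    by (rule cyc3_rel_cong_map[OF K(1) aK', of _ "(3, 1)"])
      (use fix_a[of 3 1] in \<open>simp_all add: cyc3_rel_refl\<close>)
  \<comment> \<open>Here the constants meet: \<open>a (1, 2 * \<alpha>)\<close> and
    \<open>b (3, 1)\<close> are both \<open>(1, 3 * \<alpha>)\<close>, so \<open>(3, 1)\<close>
    itself is the test point for \<open>b\<close>.\<close>
  have "?R (a (1, 2 * \<alpha>))" using p a_step by simp
  then have "?R (b (3, 1))" using a1[of "2 * \<alpha>"] \<alpha> b(1) by (simp add: algebra_simps)
  then have b_step: "?R (b z) \<longleftrightarrow> ?R z" for z
    by (intro cyc3_rel_cong_map[OF K(1) bK, of _ "(3, 1)"]) (simp_all add: cyc3_rel_refl)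
  have orbit: "?R (1, \<alpha> * Suc i)" for i
  proof (induction i)
    case 0
    show ?case using p a_step[of "(1, \<alpha>)"] a1[of \<alpha>] \<alpha> by (simp add: mult_2)
  next
    case (Suc i)
    then show ?case using a_step[of "(1, \<alpha> * Suc i)"] a1[of "\<alpha> * Suc i"] \<alpha> by (simp add: add.commute)
  qed
  \<comment> \<open>One orbit of \<open>a\<close>, the multiples of \<open>\<alpha>\<close>, is
    spread by \<open>b\<close> over all residues modulo \<open>\<alpha>\<close>.\<close>
  have "?R (1, i)" if i: "i \<in> {1..\<alpha>}" for i
    using orbit[of "i - 1"] b_step[of "(1, \<alpha> * i)"] b(6)[OF i] i by (simp del: mult_Suc_right)
  then have rays: "?R (i, m)" if "i \<in> {1, 2}" "m \<ge> 1" for i m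
    using cyc3_rel_rays_12[OF K(1) aK \<alpha>, of "(3, 1)" i m] that fix_a[of 3 1] by (simp add: a_def)
  have ray3: "?R (3, m)" if "m \<ge> 1" for m
    using that
  proof (induction m rule: less_induct)
    case (less m)
    consider "m = 1" | "m \<in> {2..c + 1}" | "m > c + 1" using less.prems by fastforce
    then show ?case
    proof cases
      case 1
      then show ?thesis by (simp add: cyc3_rel_refl)
    next
      case 2
      then show ?thesis using b_step[of "(3, m)"] b(2)[of m] rays[of 1 "3 * \<alpha> + m"] by simp
    next
      case 3
      then show ?thesis using b_step[of "(3, m)"] b(3,4) less.IH[of "m - c"] by simp
    qed
  qed
  have others: "?R (k, m)" if k: "k \<in> {4..n}" and m: "m \<ge> 1" for k m
  proof -
    obtain v d M where v: "v \<in> K" "d \<ge> 1" "M \<ge> d" "v (3, 1) = (3, 1)" "\<forall>m>M. v (k, m) = (k, m - d)"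
      "\<forall>m\<in>{1..M}. v (k, m) = (1, m)" using outer[OF k] by blast
    have v_step: "?R (v z) \<longleftrightarrow> ?R z" for z
      by (rule cyc3_rel_cong_map[OF K(1) v(1), of _ "(3, 1)"])
        (use v(4) in \<open>simp_all add: cyc3_rel_refl\<close>)
    show ?thesis
      using m
    proof (induction m rule: less_induct)
      case (less m)
      show ?case
      proof (cases "m \<le> M")
        case True
        then show ?thesis using v_step[of "(k, m)"] v(6) less.prems rays[of 1 m] by simp
      next
        case False
        then show ?thesis using v_step[of "(k, m)"] v(2,3,5) less.IH[of "m - d"] by simp
      qed
    qed
  qed
  have "?R x" if "x \<in> ray_space n" for x
  proof -
    obtain i m where im: "x = (i, m)" by force
    have "i \<in> {1, 2} \<or> i = 3 \<or> i \<in> {4..n}" "m \<ge> 1"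
      using that by (auto simp: im ray_space_def)
    then show ?thesis using rays ray3 others unfolding im by blast
  qed
  then show ?thesis by (intro Alt_subset_if_cyc3_rel[OF K(1)])
qed

lemma exists_small_generating_set:
  assumes n: "n \<ge> 3" and U: "subgroup U (ray_Sym n)" "U \<subseteq> carrier (houghton_G2 n)" "Alt (ray_space n) \<subseteq> U"
    and full: "full_rank n U"
  shows "\<exists>S. finite S \<and> card S \<le> n - 1 \<and> generate (ray_Sym n) S = U"
proof -
  have Ue: "U \<subseteq> ends n" using U(2) G2_subset_ends by blast
  define row where "row = (\<lambda>k u. u \<in> U \<and> shift u k < 0 \<and> (\<forall>j\<in>{2..n}. k < j \<longrightarrow> shift u j = 0) \<and>
    (\<forall>w\<in>U. (\<forall>j\<in>{2..n}. k < j \<longrightarrow> shift w j = 0) \<longrightarrow> shift u k dvd shift w k))"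
  have row: "\<exists>u. row k u" if "k \<in> {2..n}" for k
    using exists_hermite_row[OF U(1) Ue full that] unfolding row_def by blast
  \<comment> \<open>An even finitary factor changes no shift and stays in \<open>U\<close>, so lifts
    can be modified freely without spoiling the triangular basis.\<close>
  have row_adjust: "row k (s \<circ> u)" if u: "row k u" and k: "k \<in> {2..n}" and s: "s \<in> Alt (ray_space n)" for k u s
  proof -
    have "s \<in> ends n" "u \<in> ends n" "s \<in> FSym (ray_space n)"
      using s u Ue Alt_subset_FSym FSym_subset_ends unfolding row_def by blast+
    then have "shift (s \<circ> u) j = shift u j" if "j \<in> {2..n}" for j
      using shift_comp[of s n u j] shift_FSym that by simp
    moreover have "s \<circ> u \<in> U" using s u U(3) subgroup_Sym_comp[OF U(1)] by (auto simp: row_def)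
    ultimately show ?thesis using u k unfolding row_def by simp
  qed
  have neg: "\<exists>c\<ge>1. shift u k = - int c" if "row k u" for k u
    using that by (intro exI[of _ "nat (- shift u k)"]) (auto simp: row_def)
  have k2: "2 \<in> {2..n}" and k3: "3 \<in> {2..n}" using n by auto
  obtain u where u: "row 2 u" using row[OF k2] by blast
  obtain \<alpha> where \<alpha>: "\<alpha> \<ge> 1" "shift u 2 = - int \<alpha>" using neg[OF u] by blast
  define a where "a = houghton_gen 2 ^^ \<alpha>"
  have shift_a: "shift a j = shift u j" if "j \<in> {2..n}" for j
    using shift_houghton_gen_funpow[OF k2 that] u that \<alpha>(2) by (auto simp: a_def row_def)
  \<comment> \<open>\<open>\<alpha>\<close> is even, so \<open>a\<close> lies in
    \<open>G\<^sub>2\<close>; it has the shifts of \<open>u\<close> on rays 2 to n, and so differs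
    from \<open>u\<close> by an element of \<open>Alt\<close>, which \<open>U\<close>
    contains.\<close>
  have aU: "a \<in> U"
  proof -
    have "u \<in> U" using u by (simp add: row_def)
    then have "even (shift u 2)" using even_shift_G2[OF _ k2] U(2) by blast
    then have "even \<alpha>" using \<alpha>(2) by simp
    then obtain \<beta> where "\<alpha> = 2 * \<beta>" by (rule evenE)
    then have "a = (houghton_gen 2 ^^ 2) ^^ \<beta>" by (simp add: a_def funpow_mult)
    then have aG: "a \<in> carrier (houghton_G2 n)"
      using subgroup_Sym_funpow[OF subgroup_houghton_G2 houghton_gen_sq_in_G2[OF k2]] by simp
    have e: "a \<in> ends n" "u \<in> ends n" "inv' u \<in> ends n"
      using aG \<open>u \<in> U\<close> G2_subset_ends Ue subgroup_Sym_inv[OF subgroup_ends] by blast+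
    have "a \<circ> inv' u \<in> Alt (ray_space n)"
    proof (rule G2_kernel)
      show "a \<circ> inv' u \<in> carrier (houghton_G2 n)"
        using aG \<open>u \<in> U\<close> U(2) subgroup_Sym_comp[OF subgroup_houghton_G2]
          subgroup_Sym_inv[OF subgroup_houghton_G2] by blast
      show "shift (a \<circ> inv' u) k = 0" if "k \<in> {2..n}" for k
        using shift_comp[OF e(1,3), of k] shift_inv[OF e(2), of k] shift_a[OF that] that by simp
    qed
    then have "(a \<circ> inv' u) \<circ> u \<in> U"
      using U(3) \<open>u \<in> U\<close> subgroup_Sym_comp[OF U(1)] by blast
    then show ?thesis using ends_bij[OF e(2)] by (simp add: comp_assoc bij_is_inj)
  qed
  have row_a: "row 2 a" using u aU shift_a k2 unfolding row_def by simp
  obtain w where w: "row 3 w" using row[OF k3] by blast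
  obtain c where c: "c \<ge> 1" "shift w 3 = - int c" using neg[OF w] by blast
  have we: "w \<in> ends n" using w Ue by (auto simp: row_def)
  have w0: "shift w j = 0" if "j \<in> {4..n}" for j using w that by (simp add: row_def)
  obtain s where s: "s \<in> Alt (ray_space n)" and b: "(s \<circ> w) (3, 1) = (1, 3 * \<alpha>)"
    "\<forall>m\<in>{2..c + 1}. (s \<circ> w) (3, m) = (1, 3 * \<alpha> + m)"
    "\<forall>m>c + 1. (s \<circ> w) (3, m) = (3, m - c)"
    "\<forall>j\<in>{4..n}. \<forall>m\<ge>1. (s \<circ> w) (j, m) = (j, m)"
    "\<forall>i\<in>{1..\<alpha>}. (s \<circ> w) (1, \<alpha> * i) = (1, i)"
    "(s \<circ> w) (1, \<alpha> * (\<alpha> + 1)) = (3, 1)" "(s \<circ> w) (1, \<alpha> * (\<alpha> + 2)) = (1, 2 * \<alpha>)"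
    using exists_adjusted_third_generator[OF n we c(2,1) w0 \<alpha>(1)] by blast
  define outer where "outer = (\<lambda>k (v :: nat \<times> nat \<Rightarrow> nat \<times> nat). \<exists>c\<ge>1. v (3, 1) = (3, 1) \<and>
    (\<exists>M\<ge>c. (\<forall>m>M. v (k, m) = (k, m - c)) \<and> (\<forall>m\<in>{1..M}. v (k, m) = (1, m))))"
  have "\<exists>v. row k v \<and> outer k v" if k: "k \<in> {4..n}" for k
  proof -
    have k': "k \<in> {2..n}" using k by auto
    obtain x where x: "row k x" using row[OF k'] by blast
    obtain d where d: "d \<ge> 1" "shift x k = - int d" using neg[OF x] by blast
    have "x \<in> ends n" using x Ue by (auto simp: row_def)
    then obtain t where t: "t \<in> Alt (ray_space n)" "(t \<circ> x) (3, 1) = (3, 1)"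
      "\<exists>M\<ge>d. (\<forall>m>M. (t \<circ> x) (k, m) = (k, m - d)) \<and> (\<forall>m\<in>{1..M}. (t \<circ> x) (k, m) = (1, m))"
      using exists_adjusted_outer_generator[OF _ k d(2,1)] by blast
    then have "outer k (t \<circ> x)" using d(1) unfolding outer_def by blast
    then show ?thesis using row_adjust[OF x k' t(1)] by blast
  qed
  then obtain v where v: "\<And>k. k \<in> {4..n} \<Longrightarrow> row k (v k) \<and> outer k (v k)" by metis
  define g where "g = v(2 := a, 3 := s \<circ> w)"
  have row_g: "row k (g k)" if "k \<in> {2..n}" for k
  proof -
    consider "k = 2" | "k = 3" | "k \<in> {4..n}" using \<open>k \<in> {2..n}\<close> by fastforce
    then show ?thesis
      using row_a row_adjust[OF w k3 s] v by cases (auto simp: g_def)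
  qed
  define K where "K = generate (ray_Sym n) (g ` {2..n})"
  have gU: "g ` {2..n} \<subseteq> U" using row_g by (auto simp: row_def)
  then have KU: "K \<subseteq> U" unfolding K_def by (rule group.generate_subgroup_incl[OF group_Sym _ U(1)])
  have K: "subgroup K (ray_Sym n)"
    unfolding K_def using gU subgroup.subset[OF U(1)] by (intro group.generate_is_subgroup[OF group_Sym]) blast
  have gK: "g k \<in> K" if "k \<in> {2..n}" for k
    unfolding K_def using that by (auto intro: generate.incl)
  have "Alt (ray_space n) \<subseteq> K"
  proof (rule Alt_subset_if_adjusted_generators[OF n K _ \<alpha>(1), where b = "s \<circ> w" and c = c])
    show "K \<subseteq> ends n" using KU Ue by blast
    show "houghton_gen 2 ^^ \<alpha> \<in> K" using gK[OF k2] by (simp add: g_def a_def)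
    show "s \<circ> w \<in> K" using gK[OF k3] by (simp add: g_def)
    fix k assume k: "k \<in> {4..n}"
    have "outer k (g k)" using v[OF k] k by (simp add: g_def)
    then show "\<exists>v\<in>K. \<exists>c\<ge>1. v (3, 1) = (3, 1) \<and>
      (\<exists>M\<ge>c. (\<forall>m>M. v (k, m) = (k, m - c)) \<and> (\<forall>m\<in>{1..M}. v (k, m) = (1, m)))"
      using gK[of k] k unfolding outer_def by (intro bexI[of _ "g k"]) auto
  qed (use b c in blast)+
  then have "U \<subseteq> K"
    using row_g gK by (intro subset_if_hermite_basis[OF U(1,2) K]) (auto simp: row_def)
  then have "K = U" using KU by blast
  moreover have "card (g ` {2..n}) \<le> n - 1"
    using card_image_le[of "{2..n}" g] by simp
  ultimately show ?thesis unfolding K_def by blast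
qed

section \<open>Minimal numbers of generators\<close>

lemma min_gens_houghton:
  "min_gens (houghton n) = enat (n - 1)"
proof -
  have "min_gens ((ray_Sym n)\<lparr>carrier := carrier (houghton n)\<rparr>) = enat (n - 1)"
  proof (rule min_gens_eqI[OF subgroup_houghton])
    show "generate (ray_Sym n) (houghton_gen ` {2..n}) = carrier (houghton n)"
      by (simp add: carrier_houghton)
    show "card (houghton_gen ` {2..n}) \<le> n - 1"
      using card_image_le[of "{2..n}" houghton_gen] by simp
    fix T assume T: "finite T" "generate (ray_Sym n) T = carrier (houghton n)"
    have "T \<subseteq> ends n" using T(2) houghton_subset_ends by (auto intro: generate.incl)
    then show "n - 1 \<le> card T"
      using T full_rank_houghton by (intro card_ge_if_full_rank) auto
  qed simp
  then show ?thesis using houghton_eq by simp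
qed

lemma min_gens_finite_index:
  assumes n: "n \<ge> 3" and U: "finite_index_subgroup U (houghton_G2 n)"
  shows "min_gens ((houghton_G2 n)\<lparr>carrier := U\<rparr>) = enat (n - 1)"
proof -
  have U': "finite_index_subgroup U ((ray_Sym n)\<lparr>carrier := carrier (houghton_G2 n)\<rparr>)"
    using U houghton_G2_eq by simp
  then have sub: "subgroup U (ray_Sym n)"
    using group.incl_subgroup[OF group_Sym subgroup_houghton_G2] by (simp add: finite_index_subgroup_def)
  have UG: "U \<subseteq> carrier (houghton_G2 n)"
    using U subgroup.subset unfolding finite_index_subgroup_def by blast
  have "infinite (ray_space n)" using infinite_ray[of n "{}"] n by simp
  then have AU: "Alt (ray_space n) \<subseteq> U"
    using Alt_subset_finite_index[OF _ subgroup_houghton_G2 Alt_subset_G2 U'] by blast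
  note full = finite_index_full_rank[OF U]
  obtain S where S: "finite S" "card S \<le> n - 1" "generate (ray_Sym n) S = U"
    using exists_small_generating_set[OF n sub UG AU full] by blast
  have "min_gens ((ray_Sym n)\<lparr>carrier := U\<rparr>) = enat (n - 1)"
  proof (rule min_gens_eqI[OF sub S(1,3,2)])
    fix T assume T: "finite T" "generate (ray_Sym n) T = U"
    have "T \<subseteq> ends n" using T(2) UG G2_subset_ends by (blast intro: generate.incl)
    then show "n - 1 \<le> card T"
      using T full by (intro card_ge_if_full_rank) auto
  qed
  moreover have "(houghton_G2 n)\<lparr>carrier := U\<rparr> = (ray_Sym n)\<lparr>carrier := U\<rparr>"
    by (simp add: houghton_G2_def subgroup_generated_def)
  ultimately show ?thesis by simp
qed

lemma (in group) finite_index_self: "finite_index_subgroup (carrier G) G"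
proof -
  have "rcosets (carrier G) \<subseteq> {carrier G}"
    using coset_join2[OF _ subgroup_self] by (auto simp: RCOSETS_def)
  then show ?thesis
    using subgroup_self by (auto simp: finite_index_subgroup_def intro: finite_subset)
qed

theorem corollary4:
  fixes n :: nat
  assumes "n \<ge> 3"
  shows "finite_index_subgroup (carrier (houghton_G2 n)) (houghton n) \<and>
    (\<forall>U. finite_index_subgroup U (houghton_G2 n) \<longrightarrow>
      min_gens ((houghton_G2 n)\<lparr>carrier := U\<rparr>) = min_gens (houghton_G2 n) \<and>
      min_gens (houghton_G2 n) = min_gens (houghton n))"
proof -
  have "group (houghton_G2 n)"
    unfolding houghton_G2_def by (rule group.group_subgroup_generated[OF group_Sym])
  \<comment> \<open>\<open>G\<^sub>2\<close> has finite index in itself, so its own value is the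
    case where \<open>U\<close> is the whole carrier.\<close>
  then have "min_gens (houghton_G2 n) = enat (n - 1)"
    using min_gens_finite_index[OF assms group.finite_index_self] by simp
  then show ?thesis
    using finite_index_houghton_G2[OF assms] min_gens_finite_index[OF assms] min_gens_houghton by simp
qed

end
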